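(* In a raw type theory, the following closure rules are admissible (for every instance, if the premises are derivable then so is the conclusion): (TT-Subst) from $\Theta;\Gamma\vdash\{x:A\}\,\mathcal{J}$ and $\Theta;\Gamma\vdash t:A$ infer $\Theta;\Gamma\vdash\mathcal{J}[t/x]$; (TT-Bdry-Subst) from $\Theta;\Gamma\vdash\{x:A\}\,\mathcal{B}$ and $\Theta;\Gamma\vdash t:A$ infer $\Theta;\Gamma\vdash\mathcal{B}[t/x]$; (TT-Subst-EqTy) from $\Theta;\Gamma\vdash\{x:A\}\{\vec y:\vec B\}\,C\ \mathsf{type}$, $\Theta;\Gamma\vdash s:A$, $\Theta;\Gamma\vdash t:A$, $\Theta;\Gamma\vdash s\equiv t:A$ infer $\Theta;\Gamma\vdash\{\vec y:\vec B[s/x]\}\,C[s/x]\equiv C[t/x]$; (TT-Subst-EqTm) from $\Theta;\Gamma\vdash\{x:A\}\{\vec y:\vec B\}\,u:C$, $\Theta;\Gamma\vdash s:A$, $\Theta;\Gamma\vdash t:A$, $\Theta;\Gamma\vdash s\equiv t:A$ infer $\Theta;\Gamma\vdash\{\vec y:\vec B[s/x]\}\,u[s/x]\equiv u[t/x]:C[s/x]$; (TT-Conv-Abstr) from $\Theta;\Gamma\vdash\{x:A\}\,\mathcal{J}$, $\Theta;\Gamma\vdash B\ \mathsf{type}$, $\Theta;\Gamma\vdash A\equiv B$ infer $\Theta;\Gamma\vdash\{x:B\}\,\mathcal{J}$.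
   Context: Setting: finitary type theories over a signature $\Sigma$. Hypothetical judgements $\Theta;\Gamma\vdash\mathcal{J}$ consist of a metavariable context $\Theta$ (metavariables assigned closed abstracted boundaries), a variable context $\Gamma=[\mathsf{a}_1:A_1,\ldots,\mathsf{a}_n:A_n]$, and an abstracted judgement $\mathcal{J}=\{x_1:B_1\}\cdots\{x_m:B_m\}\,J$ with $J$ one of "$A$ type", "$t:A$", "$A\equiv B$", "$s\equiv t:A$"; boundaries $\mathcal{B}$ are the same with a placeholder $\Box$ instead of the head. $e[t/x]$ denotes substitution of $t$ for the bound variable $x$. A raw type theory is a family of raw rules; its deductive system consists of the structural rules (variable, metavariable, metavariable congruence, abstraction, equality rules including reflexivity, symmetry, transitivity and conversion, and boundary formation rules), all instantiations of its specific rules, and congruence rules for its specific object rules. *)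

theory Defs
  imports Main
begin

section \<open>Raw syntax\<close>

text \<open>
  The four syntactic classes: \<open>Obj Ty\<close>, \<open>Obj Tm\<close> are the object classes of types and terms,
  \<open>Eq Ty\<close>, \<open>Eq Tm\<close> the classes of type and term equations.
\<close>

datatype objclass = Ty | Tm

datatype synclass = Obj objclass | Eq objclass

text \<open>
  A metavariable arity, or the arity of a single symbol argument, is the syntactic class together
  with the number of bound variables. A symbol arity is the class of the expression built by the
  symbol together with the arities of its arguments.
\<close>

type_synonym arity = "synclass \<times> nat"
type_synonym symarity = "objclass \<times> arity list"
type_synonym 's signature = "'s \<rightharpoonup> symarity"

type_synonym var = nat
type_synonym mvar = nat

text \<open>
  Locally nameless syntax: free variables are names, bound variables are de Bruijn indices.
  Types, terms and arguments share one datatype; \<open>valid_expr\<close> below sorts them by class.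
  \<open>Star\<close> is the dummy argument of an equation class, \<open>Abs e\<close> the abstracted argument \<open>{x} e\<close>.
\<close>

datatype 's expr =
    FVar var
  | BVar nat
  | SApp 's "'s expr list"
  | MApp mvar "'s expr list"
  | Star objclass
  | Abs "'s expr"

text \<open>
  Theses of judgements and boundaries. In \<open>BTy\<close>, \<open>BTm A\<close>, \<open>BEqTy A B\<close>, \<open>BEqTm s t A\<close> the placeholder
  for the head is left implicit, and so is the (unique) dummy head of an equation.
\<close>

datatype 'e judgement =
    IsType 'e                \<comment> \<open>\<open>A type\<close>\<close>
  | HasType 'e 'e            \<comment> \<open>\<open>t : A\<close>\<close>
  | EqType 'e 'e             \<comment> \<open>\<open>A \<equiv> B\<close>\<close>
  | EqTerm 'e 'e 'e          \<comment> \<open>\<open>s \<equiv> t : A\<close>\<close>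

datatype 'e boundary =
    BTy
  | BTm 'e
  | BEqTy 'e 'e
  | BEqTm 'e 'e 'e

text \<open>
  \<open>Bind A X\<close> is \<open>{x : A} X\<close>; in \<open>X\<close> the index of \<open>x\<close> is the number of binders crossed since.
\<close>

datatype ('e, 'x) abstracted =
    Thesis 'x
  | Bind 'e "('e, 'x) abstracted"

type_synonym 's ajudgement = "('s expr, 's expr judgement) abstracted"
type_synonym 's aboundary = "('s expr, 's expr boundary) abstracted"

definition binds :: "'e list \<Rightarrow> 'x \<Rightarrow> ('e, 'x) abstracted" where
  "binds As x = foldr Bind As (Thesis x)"

type_synonym 's mctx = "(mvar \<times> 's aboundary) list"
type_synonym 's vctx = "(var \<times> 's expr) list"


section \<open>Substitution of bound variables\<close>

fun shift :: "nat \<Rightarrow> nat \<Rightarrow> 's expr \<Rightarrow> 's expr" where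
  "shift d k (FVar a) = FVar a"
| "shift d k (BVar i) = (if i < k then BVar i else BVar (i + d))"
| "shift d k (SApp S es) = SApp S (map (shift d k) es)"
| "shift d k (MApp M ts) = MApp M (map (shift d k) ts)"
| "shift d k (Star c) = Star c"
| "shift d k (Abs e) = Abs (shift d (Suc k) e)"

text \<open>
  \<open>subst k [t\<^sub>1, \<dots>, t\<^sub>m] e\<close> is the simultaneous substitution \<open>e[t\<^sub>1/x\<^sub>1, \<dots>, t\<^sub>m/x\<^sub>m]\<close>, where
  \<open>x\<^sub>1, \<dots>, x\<^sub>m\<close> are the variables of \<open>m\<close> consecutive binders, outermost first, inside which \<open>k\<close> further
  binders have been crossed on the way to \<open>e\<close>. Hence \<open>x\<^sub>m\<close> has index \<open>k\<close>, and \<open>x\<^sub>1\<close> has index \<open>k + m - 1\<close>.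
\<close>

fun subst :: "nat \<Rightarrow> 's expr list \<Rightarrow> 's expr \<Rightarrow> 's expr" where
  "subst k ts (FVar a) = FVar a"
| "subst k ts (BVar i) =
    (if i < k then BVar i
     else if i < k + length ts then shift k 0 (rev ts ! (i - k))
     else BVar (i - length ts))"
| "subst k ts (SApp S es) = SApp S (map (subst k ts) es)"
| "subst k ts (MApp M us) = MApp M (map (subst k ts) us)"
| "subst k ts (Star c) = Star c"
| "subst k ts (Abs e) = Abs (subst (Suc k) ts e)"

primrec subst_judgement :: "nat \<Rightarrow> 's expr \<Rightarrow> 's ajudgement \<Rightarrow> 's ajudgement" where
  "subst_judgement k t (Thesis j) = Thesis (map_judgement (subst k [t]) j)"
| "subst_judgement k t (Bind A J) = Bind (subst k [t] A) (subst_judgement (Suc k) t J)"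

primrec subst_boundary :: "nat \<Rightarrow> 's expr \<Rightarrow> 's aboundary \<Rightarrow> 's aboundary" where
  "subst_boundary k t (Thesis b) = Thesis (map_boundary (subst k [t]) b)"
| "subst_boundary k t (Bind A B) = Bind (subst k [t] A) (subst_boundary (Suc k) t B)"

text \<open>The types of a telescope \<open>{y\<^sub>1 : B\<^sub>1} \<dots> {y\<^sub>n : B\<^sub>n}\<close>: \<open>B\<^sub>i\<close> lies under \<open>i - 1\<close> of its binders.\<close>

primrec subst_tele :: "nat \<Rightarrow> 's expr \<Rightarrow> 's expr list \<Rightarrow> 's expr list" where
  "subst_tele k t [] = []"
| "subst_tele k t (B # Bs) = subst k [t] B # subst_tele (Suc k) t Bs"


section \<open>Syntactic validity\<close>

text \<open>
  \<open>valid_expr \<Sigma> \<mu> V k c n e\<close>: \<open>e\<close> is an argument of class \<open>c\<close> abstracting \<open>n\<close> variables, it respects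
  the symbol arities \<open>\<Sigma>\<close> and the metavariable arities \<open>\<mu>\<close>, its free variables are in \<open>V\<close>, and its
  unabstracted bound variables have indices below \<open>k\<close>.
\<close>

inductive valid_expr ::
    "'s signature \<Rightarrow> (mvar \<rightharpoonup> arity) \<Rightarrow> var set \<Rightarrow> nat \<Rightarrow> synclass \<Rightarrow> nat \<Rightarrow> 's expr \<Rightarrow> bool"
  for \<Sigma> :: "'s signature" and \<mu> :: "mvar \<rightharpoonup> arity" and V :: "var set" where
  "a \<in> V \<Longrightarrow> valid_expr \<Sigma> \<mu> V k (Obj Tm) 0 (FVar a)"
| "i < k \<Longrightarrow> valid_expr \<Sigma> \<mu> V k (Obj Tm) 0 (BVar i)"
| "\<Sigma> S = Some (c, ars) \<Longrightarrow> list_all2 (\<lambda>ar e. valid_expr \<Sigma> \<mu> V k (fst ar) (snd ar) e) ars es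
    \<Longrightarrow> valid_expr \<Sigma> \<mu> V k (Obj c) 0 (SApp S es)"
| "\<mu> M = Some (Obj c, length ts) \<Longrightarrow> \<forall>t \<in> set ts. valid_expr \<Sigma> \<mu> V k (Obj Tm) 0 t
    \<Longrightarrow> valid_expr \<Sigma> \<mu> V k (Obj c) 0 (MApp M ts)"
| "valid_expr \<Sigma> \<mu> V k (Eq c) 0 (Star c)"
| "valid_expr \<Sigma> \<mu> V (Suc k) c n e \<Longrightarrow> valid_expr \<Sigma> \<mu> V k c (Suc n) (Abs e)"

abbreviation "valid_type \<Sigma> \<mu> V k A \<equiv> valid_expr \<Sigma> \<mu> V k (Obj Ty) 0 A"
abbreviation "valid_term \<Sigma> \<mu> V k t \<equiv> valid_expr \<Sigma> \<mu> V k (Obj Tm) 0 t"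

primrec valid_judgement_thesis ::
    "'s signature \<Rightarrow> (mvar \<rightharpoonup> arity) \<Rightarrow> var set \<Rightarrow> nat \<Rightarrow> 's expr judgement \<Rightarrow> bool" where
  "valid_judgement_thesis \<Sigma> \<mu> V k (IsType A) = valid_type \<Sigma> \<mu> V k A"
| "valid_judgement_thesis \<Sigma> \<mu> V k (HasType t A) = (valid_term \<Sigma> \<mu> V k t \<and> valid_type \<Sigma> \<mu> V k A)"
| "valid_judgement_thesis \<Sigma> \<mu> V k (EqType A B) = (valid_type \<Sigma> \<mu> V k A \<and> valid_type \<Sigma> \<mu> V k B)"
| "valid_judgement_thesis \<Sigma> \<mu> V k (EqTerm s t A) =
    (valid_term \<Sigma> \<mu> V k s \<and> valid_term \<Sigma> \<mu> V k t \<and> valid_type \<Sigma> \<mu> V k A)"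

primrec valid_boundary_thesis ::
    "'s signature \<Rightarrow> (mvar \<rightharpoonup> arity) \<Rightarrow> var set \<Rightarrow> nat \<Rightarrow> 's expr boundary \<Rightarrow> bool" where
  "valid_boundary_thesis \<Sigma> \<mu> V k BTy = True"
| "valid_boundary_thesis \<Sigma> \<mu> V k (BTm A) = valid_type \<Sigma> \<mu> V k A"
| "valid_boundary_thesis \<Sigma> \<mu> V k (BEqTy A B) = (valid_type \<Sigma> \<mu> V k A \<and> valid_type \<Sigma> \<mu> V k B)"
| "valid_boundary_thesis \<Sigma> \<mu> V k (BEqTm s t A) =
    (valid_term \<Sigma> \<mu> V k s \<and> valid_term \<Sigma> \<mu> V k t \<and> valid_type \<Sigma> \<mu> V k A)"

primrec valid_judgement ::
    "'s signature \<Rightarrow> (mvar \<rightharpoonup> arity) \<Rightarrow> var set \<Rightarrow> nat \<Rightarrow> 's ajudgement \<Rightarrow> bool" where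
  "valid_judgement \<Sigma> \<mu> V k (Thesis j) = valid_judgement_thesis \<Sigma> \<mu> V k j"
| "valid_judgement \<Sigma> \<mu> V k (Bind A J) =
    (valid_type \<Sigma> \<mu> V k A \<and> valid_judgement \<Sigma> \<mu> V (Suc k) J)"

primrec valid_boundary ::
    "'s signature \<Rightarrow> (mvar \<rightharpoonup> arity) \<Rightarrow> var set \<Rightarrow> nat \<Rightarrow> 's aboundary \<Rightarrow> bool" where
  "valid_boundary \<Sigma> \<mu> V k (Thesis b) = valid_boundary_thesis \<Sigma> \<mu> V k b"
| "valid_boundary \<Sigma> \<mu> V k (Bind A B) =
    (valid_type \<Sigma> \<mu> V k A \<and> valid_boundary \<Sigma> \<mu> V (Suc k) B)"

primrec class_of :: "'e boundary \<Rightarrow> synclass" where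
  "class_of BTy = Obj Ty"
| "class_of (BTm A) = Obj Tm"
| "class_of (BEqTy A B) = Eq Ty"
| "class_of (BEqTm s t A) = Eq Tm"

primrec arity_of :: "('e, 'e boundary) abstracted \<Rightarrow> arity" where
  "arity_of (Thesis b) = (class_of b, 0)"
| "arity_of (Bind A B) = (case arity_of B of (c, n) \<Rightarrow> (c, Suc n))"

definition object_boundary :: "('e, 'e boundary) abstracted \<Rightarrow> bool" where
  "object_boundary B \<longleftrightarrow> fst (arity_of B) \<in> range Obj"

definition marities :: "'s mctx \<Rightarrow> mvar \<rightharpoonup> arity" where
  "marities \<Theta> M = map_option arity_of (map_of \<Theta> M)"

definition vars :: "'s vctx \<Rightarrow> var set" where
  "vars \<Gamma> = fst ` set \<Gamma>"

definition valid_mctx :: "'s signature \<Rightarrow> 's mctx \<Rightarrow> bool" where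
  "valid_mctx \<Sigma> \<Theta> \<longleftrightarrow> distinct (map fst \<Theta>) \<and>
    (\<forall>i < length \<Theta>. valid_boundary \<Sigma> (marities (take i \<Theta>)) {} 0 (snd (\<Theta> ! i)))"

definition valid_vctx :: "'s signature \<Rightarrow> 's mctx \<Rightarrow> 's vctx \<Rightarrow> bool" where
  "valid_vctx \<Sigma> \<Theta> \<Gamma> \<longleftrightarrow> distinct (map fst \<Gamma>) \<and>
    (\<forall>i < length \<Gamma>. valid_type \<Sigma> (marities \<Theta>) (vars (take i \<Gamma>)) 0 (snd (\<Gamma> ! i)))"

text \<open>Hypothetical judgements and hypothetical boundaries.\<close>

datatype 's hypothetical =
    HJ "'s mctx" "'s vctx" "'s ajudgement"
  | HB "'s mctx" "'s vctx" "'s aboundary"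

primrec valid_hypothetical :: "'s signature \<Rightarrow> 's hypothetical \<Rightarrow> bool" where
  "valid_hypothetical \<Sigma> (HJ \<Theta> \<Gamma> J) \<longleftrightarrow>
    valid_mctx \<Sigma> \<Theta> \<and> valid_vctx \<Sigma> \<Theta> \<Gamma> \<and> valid_judgement \<Sigma> (marities \<Theta>) (vars \<Gamma>) 0 J"
| "valid_hypothetical \<Sigma> (HB \<Theta> \<Gamma> B) \<longleftrightarrow>
    valid_mctx \<Sigma> \<Theta> \<and> valid_vctx \<Sigma> \<Theta> \<Gamma> \<and> valid_boundary \<Sigma> (marities \<Theta>) (vars \<Gamma>) 0 B"


section \<open>Filling of boundaries\<close>

primrec fill_thesis :: "'s expr boundary \<Rightarrow> 's expr \<Rightarrow> 's expr judgement" where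
  "fill_thesis BTy e = IsType e"
| "fill_thesis (BTm A) e = HasType e A"
| "fill_thesis (BEqTy A B) e = EqType A B"
| "fill_thesis (BEqTm s t A) e = EqTerm s t A"

text \<open>
  Boundaries are only ever filled with arguments of matching arity, and with equations only if they
  are object boundaries; the functions are unspecified otherwise.
\<close>

fun fill :: "'s aboundary \<Rightarrow> 's expr \<Rightarrow> 's ajudgement" where
  "fill (Thesis b) e = Thesis (fill_thesis b e)"
| "fill (Bind A B) (Abs e) = Bind A (fill B e)"
| "fill (Bind A B) _ = undefined"

fun fill_eq_thesis :: "'s expr boundary \<Rightarrow> 's expr \<Rightarrow> 's expr \<Rightarrow> 's expr judgement" where
  "fill_eq_thesis BTy e e' = EqType e e'"
| "fill_eq_thesis (BTm A) e e' = EqTerm e e' A"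
| "fill_eq_thesis _ e e' = undefined"

fun fill_eq :: "'s aboundary \<Rightarrow> 's expr \<Rightarrow> 's expr \<Rightarrow> 's ajudgement" where
  "fill_eq (Thesis b) e e' = Thesis (fill_eq_thesis b e e')"
| "fill_eq (Bind A B) (Abs e) (Abs e') = Bind A (fill_eq B e e')"
| "fill_eq (Bind A B) _ _ = undefined"


section \<open>Instantiations of metavariables\<close>

type_synonym 's minst = "(mvar \<times> 's expr) list"

fun strip_abs :: "nat \<Rightarrow> 's expr \<Rightarrow> 's expr" where
  "strip_abs (Suc n) (Abs e) = strip_abs n e"
| "strip_abs n e = e"

text \<open>
  If \<open>I\<close> maps \<open>M\<close> to \<open>{x\<^sub>1} \<dots> {x\<^sub>m} e\<close> then it takes \<open>M(t\<^sub>1, \<dots>, t\<^sub>m)\<close> to \<open>e[I t\<^sub>1/x\<^sub>1, \<dots>, I t\<^sub>m/x\<^sub>m]\<close>.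
\<close>

fun act :: "'s minst \<Rightarrow> 's expr \<Rightarrow> 's expr" where
  "act I (FVar a) = FVar a"
| "act I (BVar i) = BVar i"
| "act I (SApp S es) = SApp S (map (act I) es)"
| "act I (MApp M ts) =
    (case map_of I M of
       Some e \<Rightarrow> subst 0 (map (act I) ts) (strip_abs (length ts) e)
     | None \<Rightarrow> MApp M (map (act I) ts))"
| "act I (Star c) = Star c"
| "act I (Abs e) = Abs (act I e)"

abbreviation act_boundary :: "'s minst \<Rightarrow> 's aboundary \<Rightarrow> 's aboundary" where
  "act_boundary I \<equiv> map_abstracted (act I) (map_boundary (act I))"

text \<open>\<open>I\<close> is an instantiation of the metavariable context \<open>\<Xi>\<close> over \<open>\<Theta>; \<Gamma>\<close>.\<close>

definition instantiates ::
    "'s signature \<Rightarrow> 's mctx \<Rightarrow> 's vctx \<Rightarrow> 's mctx \<Rightarrow> 's minst \<Rightarrow> bool" where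
  "instantiates \<Sigma> \<Theta> \<Gamma> \<Xi> I \<longleftrightarrow>
    list_all2 (\<lambda>(M, B) (M', e). M' = M \<and>
      (case arity_of B of (c, n) \<Rightarrow> valid_expr \<Sigma> (marities \<Theta>) (vars \<Gamma>) 0 c n e)) \<Xi> I"


section \<open>Raw type theories\<close>

text \<open>
  A raw rule \<open>\<Xi> \<Longrightarrow> J\<close> is a hypothetical judgement \<open>\<Xi>; [] \<turnstile> J\<close> with \<open>J\<close> not abstracted.
\<close>

type_synonym 's raw_rule = "'s mctx \<times> 's expr judgement"

definition raw_rule :: "'s signature \<Rightarrow> 's raw_rule \<Rightarrow> bool" where
  "raw_rule \<Sigma> R \<longleftrightarrow> (case R of (\<Xi>, j) \<Rightarrow> valid_hypothetical \<Sigma> (HJ \<Xi> [] (Thesis j)))"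

definition raw_type_theory :: "'s signature \<Rightarrow> 's raw_rule set \<Rightarrow> bool" where
  "raw_type_theory \<Sigma> T \<longleftrightarrow> (\<forall>R \<in> T. raw_rule \<Sigma> R)"

primrec boundary_of :: "'e judgement \<Rightarrow> 'e boundary" where
  "boundary_of (IsType A) = BTy"
| "boundary_of (HasType t A) = BTm A"
| "boundary_of (EqType A B) = BEqTy A B"
| "boundary_of (EqTerm s t A) = BEqTm s t A"

abbreviation HJ_thesis :: "'s mctx \<Rightarrow> 's vctx \<Rightarrow> 's expr judgement \<Rightarrow> 's hypothetical" where
  "HJ_thesis \<Theta> \<Gamma> j \<equiv> HJ \<Theta> \<Gamma> (Thesis j)"

abbreviation HB_thesis :: "'s mctx \<Rightarrow> 's vctx \<Rightarrow> 's expr boundary \<Rightarrow> 's hypothetical" where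
  "HB_thesis \<Theta> \<Gamma> b \<equiv> HB \<Theta> \<Gamma> (Thesis b)"

text \<open>
  The premises \<open>\<Theta>; \<Gamma> \<turnstile> t\<^sub>j : A\<^sub>j[t\<^sub>1/x\<^sub>1, \<dots>, t\<^sub>j\<^sub>-\<^sub>1/x\<^sub>j\<^sub>-\<^sub>1]\<close> of an application to \<open>t\<^sub>1, \<dots>, t\<^sub>m\<close> of a metavariable
  with boundary \<open>{x\<^sub>1 : A\<^sub>1} \<dots> {x\<^sub>m : A\<^sub>m} b\<close>.
\<close>

definition arg_premises ::
    "'s mctx \<Rightarrow> 's vctx \<Rightarrow> 's expr list \<Rightarrow> 's expr list \<Rightarrow> 's hypothetical set" where
  "arg_premises \<Theta> \<Gamma> As ts =
    {HJ_thesis \<Theta> \<Gamma> (HasType (ts ! j) (subst 0 (take j ts) (As ! j))) | j. j < length As}"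

definition arg_eq_premises ::
    "'s mctx \<Rightarrow> 's vctx \<Rightarrow> 's expr list \<Rightarrow> 's expr list \<Rightarrow> 's expr list \<Rightarrow> 's hypothetical set" where
  "arg_eq_premises \<Theta> \<Gamma> As ss ts =
    {HJ_thesis \<Theta> \<Gamma> (EqTerm (ss ! j) (ts ! j) (subst 0 (take j ss) (As ! j))) | j. j < length As}"

text \<open>
  The premises \<open>M\<^sub>i : B\<^sub>i\<close> of a rule, instantiated by \<open>I\<close>: the boundary \<open>B\<^sub>i\<close>, instantiated by the part of
  \<open>I\<close> preceding \<open>M\<^sub>i\<close>, filled with the argument that \<open>I\<close> assigns to \<open>M\<^sub>i\<close>.
\<close>

definition rule_premises ::
    "'s mctx \<Rightarrow> 's vctx \<Rightarrow> 's mctx \<Rightarrow> 's minst \<Rightarrow> 's hypothetical set" where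
  "rule_premises \<Theta> \<Gamma> \<Xi> I =
    {HJ \<Theta> \<Gamma> (fill (act_boundary (take i I) (snd (\<Xi> ! i))) (snd (I ! i))) | i. i < length \<Xi>}"

definition rule_eq_premises ::
    "'s mctx \<Rightarrow> 's vctx \<Rightarrow> 's mctx \<Rightarrow> 's minst \<Rightarrow> 's minst \<Rightarrow> 's hypothetical set" where
  "rule_eq_premises \<Theta> \<Gamma> \<Xi> I J =
    {HJ \<Theta> \<Gamma> (fill_eq (act_boundary (take i I) (snd (\<Xi> ! i))) (snd (I ! i)) (snd (J ! i))) | i.
      i < length \<Xi> \<and> object_boundary (snd (\<Xi> ! i))}"

text \<open>
  The closure rules (set of premises, conclusion) of the deductive system of a raw type theory,
  up to the requirement that premises and conclusion be syntactically valid, which is imposed in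
  \<open>derivable\<close> below.
\<close>

inductive closure_rule ::
    "'s signature \<Rightarrow> 's raw_rule set \<Rightarrow> 's hypothetical set \<Rightarrow> 's hypothetical \<Rightarrow> bool"
  for \<Sigma> :: "'s signature" and T :: "'s raw_rule set" where
  Var:
    "map_of \<Gamma> a = Some A \<Longrightarrow>
     closure_rule \<Sigma> T {} (HJ_thesis \<Theta> \<Gamma> (HasType (FVar a) A))"
| Meta:
    "map_of \<Theta> M = Some (binds As b) \<Longrightarrow> length ts = length As \<Longrightarrow>
     closure_rule \<Sigma> T
       (arg_premises \<Theta> \<Gamma> As ts \<union> {HB_thesis \<Theta> \<Gamma> (map_boundary (subst 0 ts) b)})
       (HJ_thesis \<Theta> \<Gamma> (fill_thesis (map_boundary (subst 0 ts) b) (MApp M ts)))"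
| Meta_Congr_Ty:
    "map_of \<Theta> M = Some (binds As BTy) \<Longrightarrow> length ss = length As \<Longrightarrow> length ts = length As \<Longrightarrow>
     closure_rule \<Sigma> T
       (arg_premises \<Theta> \<Gamma> As ss \<union> arg_premises \<Theta> \<Gamma> As ts \<union> arg_eq_premises \<Theta> \<Gamma> As ss ts)
       (HJ_thesis \<Theta> \<Gamma> (EqType (MApp M ss) (MApp M ts)))"
| Meta_Congr_Tm:
    "map_of \<Theta> M = Some (binds As (BTm C)) \<Longrightarrow> length ss = length As \<Longrightarrow> length ts = length As \<Longrightarrow>
     closure_rule \<Sigma> T
       (arg_premises \<Theta> \<Gamma> As ss \<union> arg_premises \<Theta> \<Gamma> As ts \<union> arg_eq_premises \<Theta> \<Gamma> As ss ts \<union>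
        {HJ_thesis \<Theta> \<Gamma> (EqType (subst 0 ss C) (subst 0 ts C))})
       (HJ_thesis \<Theta> \<Gamma> (EqTerm (MApp M ss) (MApp M ts) (subst 0 ss C)))"
| Abstr:
    "a \<notin> vars \<Gamma> \<Longrightarrow>
     closure_rule \<Sigma> T
       {HJ_thesis \<Theta> \<Gamma> (IsType A), HJ \<Theta> (\<Gamma> @ [(a, A)]) (subst_judgement 0 (FVar a) J)}
       (HJ \<Theta> \<Gamma> (Bind A J))"
| EqTy_Refl:
    "closure_rule \<Sigma> T {HJ_thesis \<Theta> \<Gamma> (IsType A)} (HJ_thesis \<Theta> \<Gamma> (EqType A A))"
| EqTy_Sym:
    "closure_rule \<Sigma> T {HJ_thesis \<Theta> \<Gamma> (EqType A B)} (HJ_thesis \<Theta> \<Gamma> (EqType B A))"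
| EqTy_Trans:
    "closure_rule \<Sigma> T
       {HJ_thesis \<Theta> \<Gamma> (EqType A B), HJ_thesis \<Theta> \<Gamma> (EqType B C)}
       (HJ_thesis \<Theta> \<Gamma> (EqType A C))"
| EqTm_Refl:
    "closure_rule \<Sigma> T {HJ_thesis \<Theta> \<Gamma> (HasType t A)} (HJ_thesis \<Theta> \<Gamma> (EqTerm t t A))"
| EqTm_Sym:
    "closure_rule \<Sigma> T {HJ_thesis \<Theta> \<Gamma> (EqTerm s t A)} (HJ_thesis \<Theta> \<Gamma> (EqTerm t s A))"
| EqTm_Trans:
    "closure_rule \<Sigma> T
       {HJ_thesis \<Theta> \<Gamma> (EqTerm s t A), HJ_thesis \<Theta> \<Gamma> (EqTerm t u A)}
       (HJ_thesis \<Theta> \<Gamma> (EqTerm s u A))"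
| Conv_Tm:
    "closure_rule \<Sigma> T
       {HJ_thesis \<Theta> \<Gamma> (HasType t A), HJ_thesis \<Theta> \<Gamma> (EqType A B)}
       (HJ_thesis \<Theta> \<Gamma> (HasType t B))"
| Conv_EqTm:
    "closure_rule \<Sigma> T
       {HJ_thesis \<Theta> \<Gamma> (EqTerm s t A), HJ_thesis \<Theta> \<Gamma> (EqType A B)}
       (HJ_thesis \<Theta> \<Gamma> (EqTerm s t B))"
| Bdry_Ty:
    "closure_rule \<Sigma> T {} (HB_thesis \<Theta> \<Gamma> BTy)"
| Bdry_Tm:
    "closure_rule \<Sigma> T {HJ_thesis \<Theta> \<Gamma> (IsType A)} (HB_thesis \<Theta> \<Gamma> (BTm A))"
| Bdry_EqTy:
    "closure_rule \<Sigma> T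
       {HJ_thesis \<Theta> \<Gamma> (IsType A), HJ_thesis \<Theta> \<Gamma> (IsType B)}
       (HB_thesis \<Theta> \<Gamma> (BEqTy A B))"
| Bdry_EqTm:
    "closure_rule \<Sigma> T
       {HJ_thesis \<Theta> \<Gamma> (IsType A), HJ_thesis \<Theta> \<Gamma> (HasType s A), HJ_thesis \<Theta> \<Gamma> (HasType t A)}
       (HB_thesis \<Theta> \<Gamma> (BEqTm s t A))"
| Bdry_Abstr:
    "a \<notin> vars \<Gamma> \<Longrightarrow>
     closure_rule \<Sigma> T
       {HJ_thesis \<Theta> \<Gamma> (IsType A), HB \<Theta> (\<Gamma> @ [(a, A)]) (subst_boundary 0 (FVar a) B)}
       (HB \<Theta> \<Gamma> (Bind A B))"
| Specific:
    "(\<Xi>, j) \<in> T \<Longrightarrow> instantiates \<Sigma> \<Theta> \<Gamma> \<Xi> I \<Longrightarrow>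
     closure_rule \<Sigma> T
       (rule_premises \<Theta> \<Gamma> \<Xi> I \<union> {HB_thesis \<Theta> \<Gamma> (map_boundary (act I) (boundary_of j))})
       (HJ_thesis \<Theta> \<Gamma> (map_judgement (act I) j))"
| Specific_Congr_Ty:
    "(\<Xi>, IsType A) \<in> T \<Longrightarrow> instantiates \<Sigma> \<Theta> \<Gamma> \<Xi> I \<Longrightarrow> instantiates \<Sigma> \<Theta> \<Gamma> \<Xi> J \<Longrightarrow>
     closure_rule \<Sigma> T
       (rule_premises \<Theta> \<Gamma> \<Xi> I \<union> rule_premises \<Theta> \<Gamma> \<Xi> J \<union> rule_eq_premises \<Theta> \<Gamma> \<Xi> I J)
       (HJ_thesis \<Theta> \<Gamma> (EqType (act I A) (act J A)))"
| Specific_Congr_Tm: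
    "(\<Xi>, HasType t A) \<in> T \<Longrightarrow> instantiates \<Sigma> \<Theta> \<Gamma> \<Xi> I \<Longrightarrow> instantiates \<Sigma> \<Theta> \<Gamma> \<Xi> J \<Longrightarrow>
     closure_rule \<Sigma> T
       (rule_premises \<Theta> \<Gamma> \<Xi> I \<union> rule_premises \<Theta> \<Gamma> \<Xi> J \<union> rule_eq_premises \<Theta> \<Gamma> \<Xi> I J \<union>
        {HJ_thesis \<Theta> \<Gamma> (EqType (act I A) (act J A))})
       (HJ_thesis \<Theta> \<Gamma> (EqTerm (act I t) (act J t) (act I A)))"

inductive derivable :: "'s signature \<Rightarrow> 's raw_rule set \<Rightarrow> 's hypothetical \<Rightarrow> bool"
  for \<Sigma> :: "'s signature" and T :: "'s raw_rule set" where
  "closure_rule \<Sigma> T P h \<Longrightarrow> \<forall>p \<in> P. valid_hypothetical \<Sigma> p \<Longrightarrow> valid_hypothetical \<Sigma> h \<Longrightarrow>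
   \<forall>p \<in> P. derivable \<Sigma> T p \<Longrightarrow> derivable \<Sigma> T h"

definition admissible ::
    "'s signature \<Rightarrow> 's raw_rule set \<Rightarrow> 's hypothetical set \<Rightarrow> 's hypothetical \<Rightarrow> bool" where
  "admissible \<Sigma> T P h \<longleftrightarrow> ((\<forall>p \<in> P. derivable \<Sigma> T p) \<longrightarrow> derivable \<Sigma> T h)"

end

theory Submission
  imports Defs
begin

text \<open>
  Everything follows from two statements about simultaneous substitutions \<open>\<sigma>\<close> of terms over \<open>\<Delta>\<close> for the
  free variables of \<open>\<Gamma>\<close>. If \<open>\<Delta> \<turnstile> \<sigma> a : A[\<sigma>]\<close> for all \<open>a : A\<close> in \<open>\<Gamma>\<close>, then \<open>\<Gamma> \<turnstile> J\<close> implies \<open>\<Delta> \<turnstile> J[\<sigma>]\<close>. If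
  moreover \<open>\<Delta> \<turnstile> \<tau> a : A[\<tau>]\<close> and \<open>\<Delta> \<turnstile> \<sigma> a \<equiv> \<tau> a : A[\<sigma>]\<close>, then the instances of an object judgement under
  \<open>\<sigma>\<close> and \<open>\<tau>\<close> are equal over \<open>\<Delta>\<close>: each object rule is matched by its congruence rule, whose premises
  for \<open>\<sigma>\<close> and for \<open>\<tau>\<close> come from the first statement. Under a binder \<open>{x : A}\<close> both substitutions send \<open>x\<close>
  to a fresh \<open>b : A[\<sigma>]\<close>, which has type \<open>A[\<tau>]\<close> by conversion along the induction hypothesis for \<open>A\<close>;
  this is why \<open>\<sigma>\<close> and \<open>\<tau>\<close> are typed by their own instances of \<open>\<Gamma>\<close>, and no presuppositions are needed.
\<close>

section \<open>Substitution of free variables\<close>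

primrec fsubst :: "(var \<Rightarrow> 's expr) \<Rightarrow> 's expr \<Rightarrow> 's expr" where
  "fsubst \<sigma> (FVar a) = \<sigma> a"
| "fsubst \<sigma> (BVar i) = BVar i"
| "fsubst \<sigma> (SApp S es) = SApp S (map (fsubst \<sigma>) es)"
| "fsubst \<sigma> (MApp M ts) = MApp M (map (fsubst \<sigma>) ts)"
| "fsubst \<sigma> (Star c) = Star c"
| "fsubst \<sigma> (Abs e) = Abs (fsubst \<sigma> e)"

abbreviation fsubst_judgement :: "(var \<Rightarrow> 's expr) \<Rightarrow> 's ajudgement \<Rightarrow> 's ajudgement" where
  "fsubst_judgement \<sigma> \<equiv> map_abstracted (fsubst \<sigma>) (map_judgement (fsubst \<sigma>))"

abbreviation fsubst_boundary :: "(var \<Rightarrow> 's expr) \<Rightarrow> 's aboundary \<Rightarrow> 's aboundary" where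
  "fsubst_boundary \<sigma> \<equiv> map_abstracted (fsubst \<sigma>) (map_boundary (fsubst \<sigma>))"

definition fsubst_minst :: "(var \<Rightarrow> 's expr) \<Rightarrow> 's minst \<Rightarrow> 's minst" where
  "fsubst_minst \<sigma> = map (apsnd (fsubst \<sigma>))"

lemma take_fsubst_minst: "take i (fsubst_minst \<sigma> I) = fsubst_minst \<sigma> (take i I)"
  by (simp add: fsubst_minst_def take_map)

lemma nth_fsubst_minst: "i < length I \<Longrightarrow> snd (fsubst_minst \<sigma> I ! i) = fsubst \<sigma> (snd (I ! i))"
  by (simp add: fsubst_minst_def)

text \<open>
  \<open>fsubst\<close> does not shift under binders, so it is meaningful only for values without loose indices;
  excluding abstractions makes it commute with \<open>strip_abs\<close>.
\<close>

definition term_subst :: "(var \<Rightarrow> 's expr) \<Rightarrow> bool" where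
  "term_subst \<sigma> \<longleftrightarrow> (\<forall>a. (\<forall>d k. shift d k (\<sigma> a) = \<sigma> a) \<and> (\<forall>k ts. subst k ts (\<sigma> a) = \<sigma> a) \<and>
    (\<forall>e. \<sigma> a \<noteq> Abs e))"

text \<open>All unabstracted indices lie below \<open>k\<close>, hence below the cutoff
  \<open>k'\<close>, so none is moved. The case \<open>k = 0\<close> makes closed terms stable under
  shifting.\<close>

lemma shift_valid: "valid_expr \<Sigma> \<mu> V k c n e \<Longrightarrow> k \<le> k' \<Longrightarrow> shift d k' e = e"
proof (induction arbitrary: k' rule: valid_expr.induct)
  case (3 S c ars k es)
  then show ?case
    by (auto simp: list_all2_conv_all_nth in_set_conv_nth intro!: nth_equalityI)
qed (auto intro: map_idI)

lemma subst_valid: "valid_expr \<Sigma> \<mu> V k c n e \<Longrightarrow> k \<le> k' \<Longrightarrow> subst k' ts e = e"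
proof (induction arbitrary: k' rule: valid_expr.induct)
  case (3 S c ars k es)
  then show ?case
    by (auto simp: list_all2_conv_all_nth in_set_conv_nth intro!: nth_equalityI)
qed (auto intro: map_idI)

lemma term_subst_FVar: "term_subst FVar"
  by (simp add: term_subst_def)

text \<open>Validity at level 0 leaves no loose index, which gives both stability conditions, and
  abstracting 0 variables excludes \<open>Abs\<close>.\<close>

lemma term_subst_upd: "term_subst \<sigma> \<Longrightarrow> valid_term \<Sigma> \<mu> V 0 t \<Longrightarrow> term_subst (\<sigma>(a := t))"
  by (auto simp: term_subst_def shift_valid subst_valid elim: valid_expr.cases)

lemma term_subst_upd_FVar: "term_subst \<sigma> \<Longrightarrow> term_subst (\<sigma>(a := FVar b))"
  by (auto simp: term_subst_def)

lemma fsubst_cong_valid: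
  "valid_expr \<Sigma> \<mu> V k c n e \<Longrightarrow> (\<And>a. a \<in> V \<Longrightarrow> \<sigma> a = \<tau> a) \<Longrightarrow> fsubst \<sigma> e = fsubst \<tau> e"
proof (induction rule: valid_expr.induct)
  case (3 S c ars k es)
  then show ?case
    by (auto simp: list_all2_conv_all_nth in_set_conv_nth intro!: nth_equalityI)
qed auto

lemma fsubst_FVar [simp]: "fsubst FVar e = e"
  by (induction e) (auto intro: map_idI)

text \<open>Agreement on the empty set of variables is vacuous, so \<open>\<sigma>\<close> can be
  compared with the identity \<open>FVar\<close>. This applies to the boundaries in a metavariable
  context.\<close>

lemma fsubst_closed: "valid_expr \<Sigma> \<mu> {} k c n e \<Longrightarrow> fsubst \<sigma> e = e"
  using fsubst_cong_valid[of \<Sigma> \<mu> "{}" k c n e \<sigma> FVar] by simp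

lemma valid_expr_fsubst:
  assumes "valid_expr \<Sigma> \<mu> V k c n e" "\<And>a. a \<in> V \<Longrightarrow> valid_term \<Sigma> \<mu> W 0 (\<sigma> a)"
  shows "valid_expr \<Sigma> \<mu> W k c n (fsubst \<sigma> e)"
proof -
  \<comment> \<open>The values of \<open>\<sigma>\<close> are valid at level 0, but a free variable
    may occur under \<open>k\<close> binders, where its value is needed at level
    \<open>k\<close>.\<close>
  have mono: "valid_expr \<Sigma> \<mu> W k c n e \<Longrightarrow> k \<le> k' \<Longrightarrow> valid_expr \<Sigma> \<mu> W k' c n e" for k k' c n e
  proof (induction arbitrary: k' rule: valid_expr.induct)
    case (3 S c ars k es)
    then show ?case
      by (auto intro!: valid_expr.intros elim!: list_all2_mono)
  qed (auto intro: valid_expr.intros)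
  show ?thesis
    using assms
  proof (induction rule: valid_expr.induct)
    case (1 a k)
    then show ?case using mono[of 0] by simp
  next
    case (3 S c ars k es)
    then show ?case
      by (auto intro!: valid_expr.intros simp: list_all2_conv_all_nth)
  qed (auto intro!: valid_expr.intros)
qed

lemma fsubst_shift: "term_subst \<sigma> \<Longrightarrow> fsubst \<sigma> (shift d k e) = shift d k (fsubst \<sigma> e)"
  by (induction e arbitrary: k) (auto simp: term_subst_def)

text \<open>At a free variable the right side still applies \<open>subst\<close> to the value
  \<open>\<sigma> a\<close>, and at a replaced index \<open>fsubst\<close> has to pass a shift.
  \<open>term_subst\<close> makes both harmless.\<close>

lemma fsubst_subst:
  "term_subst \<sigma> \<Longrightarrow> fsubst \<sigma> (subst k ts e) = subst k (map (fsubst \<sigma>) ts) (fsubst \<sigma> e)"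
proof (induction e arbitrary: k)
  case (FVar a)
  then show ?case by (auto simp: term_subst_def)
next
  case (BVar i)
  then show ?case by (auto simp: fsubst_shift rev_map)
qed auto

lemma fsubst_strip_abs:
  "term_subst \<sigma> \<Longrightarrow> strip_abs n (fsubst \<sigma> e) = fsubst \<sigma> (strip_abs n e)"
proof (induction n e rule: strip_abs.induct)
  \<comment> \<open>A free variable is the only expression that \<open>fsubst\<close> could turn
    into an abstraction to be stripped.\<close>
  case ("2_2" n a)
  then show ?case by (cases n; cases "\<sigma> a") (auto simp: term_subst_def)
qed auto

lemma map_of_fsubst_minst: "map_of (fsubst_minst \<sigma> I) M = map_option (fsubst \<sigma>) (map_of I M)"
  by (induction I) (auto simp: fsubst_minst_def)

text \<open>Since \<open>e\<close> has no free variables of its own, \<open>\<sigma>\<close> only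
  meets the arguments supplied by \<open>I\<close>. At a metavariable it passes through
  \<open>strip_abs\<close> and through the substitution of the arguments.\<close>

lemma fsubst_act_closed:
  "valid_expr \<Sigma> \<mu> {} k c n e \<Longrightarrow> term_subst \<sigma> \<Longrightarrow> fsubst \<sigma> (act I e) = act (fsubst_minst \<sigma> I) e"
proof (induction rule: valid_expr.induct)
  case (3 S c ars k es)
  then show ?case
    by (auto simp: list_all2_conv_all_nth in_set_conv_nth intro!: nth_equalityI)
next
  case (4 M c ts k)
  then have ts: "map (fsubst \<sigma> \<circ> act I) ts = map (act (fsubst_minst \<sigma> I)) ts" by auto
  show ?case
    using 4(3) by (cases "map_of I M") (simp_all add: map_of_fsubst_minst fsubst_subst fsubst_strip_abs ts)
qed auto

section \<open>Judgements and boundaries\<close>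

lemma fsubst_judgement_subst:
  "term_subst \<sigma> \<Longrightarrow> fsubst_judgement \<sigma> (subst_judgement k t J) =
    subst_judgement k (fsubst \<sigma> t) (fsubst_judgement \<sigma> J)"
  by (induction J arbitrary: k) (auto simp: judgement.map_comp fsubst_subst intro!: judgement.map_cong)

lemma fsubst_boundary_subst:
  "term_subst \<sigma> \<Longrightarrow> fsubst_boundary \<sigma> (subst_boundary k t B) =
    subst_boundary k (fsubst \<sigma> t) (fsubst_boundary \<sigma> B)"
  by (induction B arbitrary: k) (auto simp: boundary.map_comp fsubst_subst intro!: boundary.map_cong)

lemma fsubst_judgement_cong_valid:
  assumes "valid_judgement \<Sigma> \<mu> V k J" "\<And>a. a \<in> V \<Longrightarrow> \<sigma> a = \<tau> a"
  shows "fsubst_judgement \<sigma> J = fsubst_judgement \<tau> J"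
  using assms(1)
proof (induction J arbitrary: k)
  case (Thesis j)
  then show ?case by (cases j) (auto intro: fsubst_cong_valid assms(2))
qed (auto intro: fsubst_cong_valid assms(2))

lemma fsubst_boundary_cong_valid:
  assumes "valid_boundary \<Sigma> \<mu> V k B" "\<And>a. a \<in> V \<Longrightarrow> \<sigma> a = \<tau> a"
  shows "fsubst_boundary \<sigma> B = fsubst_boundary \<tau> B"
  using assms(1)
proof (induction B arbitrary: k)
  case (Thesis b)
  then show ?case by (cases b) (auto intro: fsubst_cong_valid assms(2))
qed (auto intro: fsubst_cong_valid assms(2))

lemma fsubst_judgement_FVar [simp]: "fsubst_judgement FVar J = J"
  by (induction J) (auto simp: judgement.map_ident)

lemma fsubst_boundary_FVar [simp]: "fsubst_boundary FVar B = B"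
  by (induction B) (auto simp: boundary.map_ident)

lemma valid_judgement_fsubst:
  assumes "valid_judgement \<Sigma> \<mu> V k J" "\<And>a. a \<in> V \<Longrightarrow> valid_term \<Sigma> \<mu> W 0 (\<sigma> a)"
  shows "valid_judgement \<Sigma> \<mu> W k (fsubst_judgement \<sigma> J)"
  using assms(1)
proof (induction J arbitrary: k)
  case (Thesis j)
  then show ?case by (cases j) (auto intro: valid_expr_fsubst assms(2))
qed (auto intro: valid_expr_fsubst assms(2))

lemma valid_boundary_fsubst:
  assumes "valid_boundary \<Sigma> \<mu> V k B" "\<And>a. a \<in> V \<Longrightarrow> valid_term \<Sigma> \<mu> W 0 (\<sigma> a)"
  shows "valid_boundary \<Sigma> \<mu> W k (fsubst_boundary \<sigma> B)"
  using assms(1)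
proof (induction B arbitrary: k)
  case (Thesis b)
  then show ?case by (cases b) (auto intro: valid_expr_fsubst assms(2))
qed (auto intro: valid_expr_fsubst assms(2))

lemma class_of_map_boundary [simp]: "class_of (map_boundary f b) = class_of b"
  by (cases b) auto

lemma arity_of_map [simp]: "arity_of (map_abstracted f (map_boundary g) B) = arity_of B"
  by (induction B) auto

lemma fsubst_fill_thesis:
  "map_judgement (fsubst \<sigma>) (fill_thesis b e) = fill_thesis (map_boundary (fsubst \<sigma>) b) (fsubst \<sigma> e)"
  by (cases b) auto

inductive_cases valid_expr_SucE: "valid_expr \<Sigma> \<mu> V k c (Suc n) e"

text \<open>Validity at the arity of \<open>B\<close> gives \<open>e\<close> one \<open>Abs\<close>
  for each binder of \<open>B\<close>, so \<open>fill\<close> never reaches its unspecified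
  clause.\<close>

lemma fsubst_fill:
  "valid_expr \<Sigma> \<mu> V k c n e \<Longrightarrow> arity_of B = (c, n) \<Longrightarrow>
    fsubst_judgement \<sigma> (fill B e) = fill (fsubst_boundary \<sigma> B) (fsubst \<sigma> e)"
proof (induction B arbitrary: k n e)
  case (Thesis b)
  then show ?case by (simp add: fsubst_fill_thesis)
next
  case (Bind A B)
  then obtain n' where n: "n = Suc n'" "arity_of B = (c, n')"
    by (auto split: prod.splits)
  with Bind.prems obtain e' where "e = Abs e'" "valid_expr \<Sigma> \<mu> V (Suc k) c n' e'"
    by (auto elim: valid_expr_SucE)
  with Bind.IH n show ?case by auto
qed

text \<open>The restriction to object boundaries avoids \<open>fill_eq_thesis\<close> on equation
  boundaries, where it is unspecified; \<open>rule_eq_premises\<close> is restricted in the same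
  way.\<close>

lemma fsubst_fill_eq:
  "valid_expr \<Sigma> \<mu> V k c n e \<Longrightarrow> valid_expr \<Sigma> \<mu> V k c n e' \<Longrightarrow> arity_of B = (c, n) \<Longrightarrow>
    object_boundary B \<Longrightarrow>
    fsubst_judgement \<sigma> (fill_eq B e e') = fill_eq (fsubst_boundary \<sigma> B) (fsubst \<sigma> e) (fsubst \<sigma> e')"
proof (induction B arbitrary: k n e e')
  case (Thesis b)
  then show ?case by (cases b) (auto simp: object_boundary_def)
next
  case (Bind A B)
  then obtain n' where n: "n = Suc n'" "arity_of B = (c, n')"
    by (auto split: prod.splits)
  with Bind.prems obtain d d' where "e = Abs d" "valid_expr \<Sigma> \<mu> V (Suc k) c n' d"
    "e' = Abs d'" "valid_expr \<Sigma> \<mu> V (Suc k) c n' d'"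
    by (auto elim!: valid_expr_SucE)
  with Bind.IH[of "Suc k" n' d d'] Bind.prems n show ?case by (auto simp: object_boundary_def)
qed

lemma fsubst_boundary_act_closed:
  assumes "valid_boundary \<Sigma> \<mu> {} k B" "term_subst \<sigma>"
  shows "fsubst_boundary \<sigma> (act_boundary I B) = act_boundary (fsubst_minst \<sigma> I) B"
  using assms(1)
proof (induction B arbitrary: k)
  case (Thesis b)
  then show ?case using assms(2) by (cases b) (auto intro: fsubst_act_closed)
qed (use assms(2) in \<open>auto intro: fsubst_act_closed\<close>)

lemma fsubst_judgement_act_closed:
  assumes "valid_judgement_thesis \<Sigma> \<mu> {} k j" "term_subst \<sigma>"
  shows "map_judgement (fsubst \<sigma>) (map_judgement (act I) j) = map_judgement (act (fsubst_minst \<sigma> I)) j"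
  using assms by (cases j) (auto intro: fsubst_act_closed)

lemma fsubst_boundary_of_act_closed:
  assumes "valid_judgement_thesis \<Sigma> \<mu> {} k j" "term_subst \<sigma>"
  shows "map_boundary (fsubst \<sigma>) (map_boundary (act I) (boundary_of j)) =
    map_boundary (act (fsubst_minst \<sigma> I)) (boundary_of j)"
  using assms by (cases j) (auto intro: fsubst_act_closed)

section \<open>Instantiations of metavariables under substitution\<close>

lemma instantiates_fsubst:
  assumes "instantiates \<Sigma> \<Theta> \<Gamma> \<Xi> I"
    "\<And>a. a \<in> vars \<Gamma> \<Longrightarrow> valid_term \<Sigma> (marities \<Theta>) (vars \<Delta>) 0 (\<sigma> a)"
  shows "instantiates \<Sigma> \<Theta> \<Delta> \<Xi> (fsubst_minst \<sigma> I)"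
  using assms(1) unfolding instantiates_def fsubst_minst_def list_all2_map2
  by (rule list_all2_mono) (auto intro!: valid_expr_fsubst[OF _ assms(2)])

lemma instantiates_nth:
  assumes "instantiates \<Sigma> \<Theta> \<Gamma> \<Xi> I" "i < length \<Xi>" "arity_of (snd (\<Xi> ! i)) = (c, n)"
  shows "valid_expr \<Sigma> (marities \<Theta>) (vars \<Gamma>) 0 c n (snd (I ! i))"
  using assms unfolding instantiates_def list_all2_conv_all_nth
  by (cases "\<Xi> ! i"; cases "I ! i") auto

lemma instantiates_length: "instantiates \<Sigma> \<Theta> \<Gamma> \<Xi> I \<Longrightarrow> length I = length \<Xi>"
  unfolding instantiates_def by (auto dest: list_all2_lengthD)

section \<open>Closure rules under substitution\<close>

lemma raw_rule_closed:
  assumes "raw_type_theory \<Sigma> T" "(\<Xi>, j) \<in> T"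
  shows "valid_mctx \<Sigma> \<Xi>" "valid_judgement_thesis \<Sigma> (marities \<Xi>) {} 0 j"
  using assms unfolding raw_type_theory_def raw_rule_def by (auto simp: vars_def)

lemma valid_mctx_nth:
  "valid_mctx \<Sigma> \<Xi> \<Longrightarrow> i < length \<Xi> \<Longrightarrow> \<exists>\<mu>. valid_boundary \<Sigma> \<mu> {} 0 (snd (\<Xi> ! i))"
  unfolding valid_mctx_def by blast

lemma valid_mctx_map_of:
  assumes "valid_mctx \<Sigma> \<Theta>" "map_of \<Theta> M = Some B"
  shows "\<exists>\<mu>. valid_boundary \<Sigma> \<mu> {} 0 B"
proof -
  from assms(2) obtain i where "i < length \<Theta>" "\<Theta> ! i = (M, B)"
    by (metis map_of_SomeD in_set_conv_nth)
  with valid_mctx_nth[OF assms(1)] show ?thesis by fastforce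
qed

lemma valid_boundary_binds:
  "valid_boundary \<Sigma> \<mu> V k (binds As b) \<longleftrightarrow>
    (\<forall>j < length As. valid_type \<Sigma> \<mu> V (k + j) (As ! j)) \<and>
    valid_boundary_thesis \<Sigma> \<mu> V (k + length As) b"
  by (induction As arbitrary: k) (auto simp: binds_def All_less_Suc2)

text \<open>Boundaries in a valid metavariable context have no free variables. Substituting into an
  instance of \<open>As ! j\<close> or \<open>b\<close> therefore affects only the arguments of the
  metavariable.\<close>

lemma meta_closed:
  assumes "valid_mctx \<Sigma> \<Theta>" "map_of \<Theta> M = Some (binds As b)"
  shows "j < length As \<Longrightarrow> fsubst \<sigma> (As ! j) = As ! j" "map_boundary (fsubst \<sigma>) b = b"
proof -
  from valid_mctx_map_of[OF assms] obtain \<mu> where v: "valid_boundary \<Sigma> \<mu> {} 0 (binds As b)" ..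
  show "j < length As \<Longrightarrow> fsubst \<sigma> (As ! j) = As ! j"
    using v by (auto simp: valid_boundary_binds intro: fsubst_closed)
  show "map_boundary (fsubst \<sigma>) b = b"
    using v by (cases b) (auto simp: valid_boundary_binds intro: fsubst_closed)
qed

text \<open>The target context is a separate argument because \<open>\<sigma>\<close> does not
  determine it.\<close>

primrec fsubst_hyp :: "'s vctx \<Rightarrow> (var \<Rightarrow> 's expr) \<Rightarrow> 's hypothetical \<Rightarrow> 's hypothetical" where
  "fsubst_hyp \<Delta> \<sigma> (HJ \<Theta> \<Gamma> J) = HJ \<Theta> \<Delta> (fsubst_judgement \<sigma> J)"
| "fsubst_hyp \<Delta> \<sigma> (HB \<Theta> \<Gamma> B) = HB \<Theta> \<Delta> (fsubst_boundary \<sigma> B)"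

primrec mctx_of :: "'s hypothetical \<Rightarrow> 's mctx" where
  "mctx_of (HJ \<Theta> \<Gamma> J) = \<Theta>"
| "mctx_of (HB \<Theta> \<Gamma> B) = \<Theta>"

primrec vctx_of :: "'s hypothetical \<Rightarrow> 's vctx" where
  "vctx_of (HJ \<Theta> \<Gamma> J) = \<Gamma>"
| "vctx_of (HB \<Theta> \<Gamma> B) = \<Gamma>"

lemma map_subst_fsubst:
  assumes "term_subst \<sigma>" "map_boundary (fsubst \<sigma>) b = b"
  shows "map_boundary (fsubst \<sigma>) (map_boundary (subst 0 ts) b) = map_boundary (subst 0 (map (fsubst \<sigma>) ts)) b"
  using assms by (cases b) (auto simp: fsubst_subst)

lemma arg_premises_fsubst:
  assumes "term_subst \<sigma>" "length ts = length As" "\<And>j. j < length As \<Longrightarrow> fsubst \<sigma> (As ! j) = As ! j"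
  shows "arg_premises \<Theta> \<Delta> As (map (fsubst \<sigma>) ts) = fsubst_hyp \<Delta> \<sigma> ` arg_premises \<Theta> \<Gamma> As ts"
  unfolding arg_premises_def setcompr_eq_image image_image
  by (rule image_cong) (auto simp: assms fsubst_subst take_map)

lemma arg_eq_premises_fsubst:
  assumes "term_subst \<sigma>" "length ss = length As" "length ts = length As"
    "\<And>j. j < length As \<Longrightarrow> fsubst \<sigma> (As ! j) = As ! j"
  shows "arg_eq_premises \<Theta> \<Delta> As (map (fsubst \<sigma>) ss) (map (fsubst \<sigma>) ts) =
    fsubst_hyp \<Delta> \<sigma> ` arg_eq_premises \<Theta> \<Gamma> As ss ts"
  unfolding arg_eq_premises_def setcompr_eq_image image_image
  by (rule image_cong) (auto simp: assms fsubst_subst take_map)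

text \<open>The prefixes of \<open>I\<close>, the boundaries instantiated by them and their filling
  all commute with \<open>\<sigma>\<close>, so substituting into the premises amounts to changing
  the instantiation.\<close>

lemma rule_premises_fsubst:
  assumes "term_subst \<sigma>" "valid_mctx \<Sigma> \<Xi>" "instantiates \<Sigma> \<Theta> \<Gamma> \<Xi> I"
  shows "rule_premises \<Theta> \<Delta> \<Xi> (fsubst_minst \<sigma> I) = fsubst_hyp \<Delta> \<sigma> ` rule_premises \<Theta> \<Gamma> \<Xi> I"
proof -
  have "fill (act_boundary (take i (fsubst_minst \<sigma> I)) (snd (\<Xi> ! i))) (snd (fsubst_minst \<sigma> I ! i)) =
    fsubst_judgement \<sigma> (fill (act_boundary (take i I) (snd (\<Xi> ! i))) (snd (I ! i)))"
    if i: "i < length \<Xi>" for i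
  proof -
    obtain c n where ar: "arity_of (snd (\<Xi> ! i)) = (c, n)" by fastforce
    from valid_mctx_nth[OF assms(2) i] obtain \<mu> where "valid_boundary \<Sigma> \<mu> {} 0 (snd (\<Xi> ! i))" ..
    from fsubst_boundary_act_closed[OF this assms(1)]
    show ?thesis
      using fsubst_fill[OF instantiates_nth[OF assms(3) i ar], of "act_boundary (take i I) (snd (\<Xi> ! i))"]
        ar i instantiates_length[OF assms(3)]
      by (simp add: take_fsubst_minst nth_fsubst_minst)
  qed
  then show ?thesis
    unfolding rule_premises_def setcompr_eq_image image_image by (intro image_cong) auto
qed


lemma rule_eq_premises_fsubst:
  assumes "term_subst \<sigma>" "valid_mctx \<Sigma> \<Xi>" "instantiates \<Sigma> \<Theta> \<Gamma> \<Xi> I" "instantiates \<Sigma> \<Theta> \<Gamma> \<Xi> J"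
  shows "rule_eq_premises \<Theta> \<Delta> \<Xi> (fsubst_minst \<sigma> I) (fsubst_minst \<sigma> J) =
    fsubst_hyp \<Delta> \<sigma> ` rule_eq_premises \<Theta> \<Gamma> \<Xi> I J"
proof -
  have "fill_eq (act_boundary (take i (fsubst_minst \<sigma> I)) (snd (\<Xi> ! i)))
      (snd (fsubst_minst \<sigma> I ! i)) (snd (fsubst_minst \<sigma> J ! i)) =
    fsubst_judgement \<sigma> (fill_eq (act_boundary (take i I) (snd (\<Xi> ! i))) (snd (I ! i)) (snd (J ! i)))"
    if i: "i < length \<Xi>" and ob: "object_boundary (snd (\<Xi> ! i))" for i
  proof -
    obtain c n where ar: "arity_of (snd (\<Xi> ! i)) = (c, n)" by fastforce
    from valid_mctx_nth[OF assms(2) i] obtain \<mu> where "valid_boundary \<Sigma> \<mu> {} 0 (snd (\<Xi> ! i))" ..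
    from fsubst_boundary_act_closed[OF this assms(1)]
    show ?thesis
      using fsubst_fill_eq[OF instantiates_nth[OF assms(3) i ar] instantiates_nth[OF assms(4) i ar],
          of "act_boundary (take i I) (snd (\<Xi> ! i))"]
        ar i ob instantiates_length[OF assms(3)] instantiates_length[OF assms(4)]
      by (simp add: take_fsubst_minst nth_fsubst_minst object_boundary_def)
  qed
  then show ?thesis
    unfolding rule_eq_premises_def setcompr_eq_image image_image by (intro image_cong) auto
qed

text \<open>All rules but three are local: their premises share the contexts of the conclusion, and
  substituting throughout yields another instance of a closure rule. The exceptions are the variable
  rule, whose subject becomes an arbitrary term, and the two abstraction rules, which extend the
  context.\<close>

lemma closure_rule_fsubst_cases:
  assumes "closure_rule \<Sigma> T P h" "raw_type_theory \<Sigma> T" "valid_mctx \<Sigma> (mctx_of h)" "term_subst \<sigma>"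
    "\<forall>a \<in> vars (vctx_of h). valid_term \<Sigma> (marities (mctx_of h)) (vars \<Delta>) 0 (\<sigma> a)"
  obtains
    (Var) \<Theta> \<Gamma> a A where "h = HJ_thesis \<Theta> \<Gamma> (HasType (FVar a) A)" "map_of \<Gamma> a = Some A"
  | (Abstr) \<Theta> \<Gamma> a A J where "h = HJ \<Theta> \<Gamma> (Bind A J)" "a \<notin> vars \<Gamma>"
      "P = {HJ_thesis \<Theta> \<Gamma> (IsType A), HJ \<Theta> (\<Gamma> @ [(a, A)]) (subst_judgement 0 (FVar a) J)}"
  | (Bdry_Abstr) \<Theta> \<Gamma> a A B where "h = HB \<Theta> \<Gamma> (Bind A B)" "a \<notin> vars \<Gamma>"
      "P = {HJ_thesis \<Theta> \<Gamma> (IsType A), HB \<Theta> (\<Gamma> @ [(a, A)]) (subst_boundary 0 (FVar a) B)}"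
  | (Local) "closure_rule \<Sigma> T (fsubst_hyp \<Delta> \<sigma> ` P) (fsubst_hyp \<Delta> \<sigma> h)"
      "\<And>p. p \<in> P \<Longrightarrow> mctx_of p = mctx_of h \<and> vctx_of p = vctx_of h"
  using assms(1)
proof cases
  case (Meta \<Theta> M As b ts \<Gamma>)
  note closed = meta_closed[OF _ Meta(3), where \<Sigma> = \<Sigma> and \<sigma> = \<sigma>]
  have "closure_rule \<Sigma> T (fsubst_hyp \<Delta> \<sigma> ` P) (fsubst_hyp \<Delta> \<sigma> h)"
    using closure_rule.Meta[OF Meta(3), of "map (fsubst \<sigma>) ts" \<Sigma> T \<Delta>] Meta assms(3,4) closed
    by (simp add: arg_premises_fsubst[of \<sigma> ts As \<Theta> \<Delta> \<Gamma>] fsubst_fill_thesis map_subst_fsubst)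
  with Meta show thesis by (intro Local) (auto simp: arg_premises_def)
next
  case (Meta_Congr_Ty \<Theta> M As ss ts \<Gamma>)
  note closed = meta_closed[OF _ Meta_Congr_Ty(3), where \<Sigma> = \<Sigma> and \<sigma> = \<sigma>]
  have "closure_rule \<Sigma> T (fsubst_hyp \<Delta> \<sigma> ` P) (fsubst_hyp \<Delta> \<sigma> h)"
    using closure_rule.Meta_Congr_Ty[OF Meta_Congr_Ty(3), of "map (fsubst \<sigma>) ss" "map (fsubst \<sigma>) ts" \<Sigma> T \<Delta>]
      Meta_Congr_Ty assms(3,4) closed
    by (simp add: arg_premises_fsubst[of \<sigma> _ As \<Theta> \<Delta> \<Gamma>] arg_eq_premises_fsubst[of \<sigma> ss As ts \<Theta> \<Delta> \<Gamma>] image_Un)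
  with Meta_Congr_Ty show thesis by (intro Local) (auto simp: arg_premises_def arg_eq_premises_def)
next
  case (Meta_Congr_Tm \<Theta> M As C ss ts \<Gamma>)
  note closed = meta_closed[OF _ Meta_Congr_Tm(3), where \<Sigma> = \<Sigma> and \<sigma> = \<sigma>]
  have "closure_rule \<Sigma> T (fsubst_hyp \<Delta> \<sigma> ` P) (fsubst_hyp \<Delta> \<sigma> h)"
    using closure_rule.Meta_Congr_Tm[OF Meta_Congr_Tm(3), of "map (fsubst \<sigma>) ss" "map (fsubst \<sigma>) ts" \<Sigma> T \<Delta>]
      Meta_Congr_Tm assms(3,4) closed
    by (simp add: arg_premises_fsubst[of \<sigma> _ As \<Theta> \<Delta> \<Gamma>] arg_eq_premises_fsubst[of \<sigma> ss As ts \<Theta> \<Delta> \<Gamma>]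
        image_Un fsubst_subst)
  with Meta_Congr_Tm show thesis by (intro Local) (auto simp: arg_premises_def arg_eq_premises_def)
next
  case (Specific \<Xi> j \<Theta> \<Gamma> I)
  note rule = raw_rule_closed[OF assms(2) Specific(3)]
  \<comment> \<open>The substituted instance belongs to the same specific rule. No part of that rule
    changes, because it is stated over the empty variable context.\<close>
  have "instantiates \<Sigma> \<Theta> \<Delta> \<Xi> (fsubst_minst \<sigma> I)"
    using instantiates_fsubst[OF Specific(4)] assms(5) Specific by simp
  from closure_rule.Specific[OF Specific(3) this]
  have "closure_rule \<Sigma> T (fsubst_hyp \<Delta> \<sigma> ` P) (fsubst_hyp \<Delta> \<sigma> h)"
    using Specific assms(4) rule
    by (simp add: rule_premises_fsubst fsubst_judgement_act_closed fsubst_boundary_of_act_closed image_Un)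
  with Specific show thesis by (intro Local) (auto simp: rule_premises_def)
next
  case (Specific_Congr_Ty \<Xi> A \<Theta> \<Gamma> I J)
  note rule = raw_rule_closed[OF assms(2) Specific_Congr_Ty(3)]
  have "instantiates \<Sigma> \<Theta> \<Delta> \<Xi> (fsubst_minst \<sigma> I)" "instantiates \<Sigma> \<Theta> \<Delta> \<Xi> (fsubst_minst \<sigma> J)"
    using instantiates_fsubst[OF Specific_Congr_Ty(4)] instantiates_fsubst[OF Specific_Congr_Ty(5)]
      assms(5) Specific_Congr_Ty by simp_all
  from closure_rule.Specific_Congr_Ty[OF Specific_Congr_Ty(3) this]
  have "closure_rule \<Sigma> T (fsubst_hyp \<Delta> \<sigma> ` P) (fsubst_hyp \<Delta> \<sigma> h)"
    using Specific_Congr_Ty assms(4) rule fsubst_act_closed[of \<Sigma> "marities \<Xi>" 0 "Obj Ty" 0 A \<sigma>]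
    by (simp add: rule_premises_fsubst rule_eq_premises_fsubst image_Un)
  with Specific_Congr_Ty show thesis
    by (intro Local) (auto simp: rule_premises_def rule_eq_premises_def)
next
  case (Specific_Congr_Tm \<Xi> t A \<Theta> \<Gamma> I J)
  note rule = raw_rule_closed[OF assms(2) Specific_Congr_Tm(3)]
  have "instantiates \<Sigma> \<Theta> \<Delta> \<Xi> (fsubst_minst \<sigma> I)" "instantiates \<Sigma> \<Theta> \<Delta> \<Xi> (fsubst_minst \<sigma> J)"
    using instantiates_fsubst[OF Specific_Congr_Tm(4)] instantiates_fsubst[OF Specific_Congr_Tm(5)]
      assms(5) Specific_Congr_Tm by simp_all
  from closure_rule.Specific_Congr_Tm[OF Specific_Congr_Tm(3) this]
  have "closure_rule \<Sigma> T (fsubst_hyp \<Delta> \<sigma> ` P) (fsubst_hyp \<Delta> \<sigma> h)"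
    using Specific_Congr_Tm assms(4) rule fsubst_act_closed[of \<Sigma> "marities \<Xi>" 0 "Obj Ty" 0 A \<sigma>]
      fsubst_act_closed[of \<Sigma> "marities \<Xi>" 0 "Obj Tm" 0 t \<sigma>]
    by (simp add: rule_premises_fsubst rule_eq_premises_fsubst image_Un)
  with Specific_Congr_Tm show thesis
    by (intro Local) (auto simp: rule_premises_def rule_eq_premises_def)
qed (use that in \<open>(fastforce intro: closure_rule.intros)+\<close>)

section \<open>Admissibility of substitution\<close>

lemma derivable_valid: "derivable \<Sigma> T h \<Longrightarrow> valid_hypothetical \<Sigma> h"
  by (erule derivable.cases) simp

text \<open>Derivability already includes validity, so the validity condition on the premises is
  automatic.\<close>

lemma derivable_rule:
  "closure_rule \<Sigma> T P h \<Longrightarrow> \<forall>p \<in> P. derivable \<Sigma> T p \<Longrightarrow> valid_hypothetical \<Sigma> h \<Longrightarrow> derivable \<Sigma> T h"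
  using derivable_valid by (metis derivable.intros)

lemma valid_expr_mono: "valid_expr \<Sigma> \<mu> V k c n e \<Longrightarrow> V \<subseteq> W \<Longrightarrow> valid_expr \<Sigma> \<mu> W k c n e"
  using valid_expr_fsubst[of \<Sigma> \<mu> V k c n e W FVar] by (auto intro: valid_expr.intros)

lemma vars_snoc [simp]: "vars (\<Gamma> @ [(a, A)]) = insert a (vars \<Gamma>)"
  by (auto simp: vars_def)

lemma finite_vars: "finite (vars \<Gamma>)"
  by (simp add: vars_def)

lemma fresh_var: "\<exists>b. b \<notin> vars \<Gamma>"
  using finite_vars ex_new_if_finite infinite_UNIV_nat by blast

lemma map_of_vars: "map_of \<Gamma> a = Some A \<Longrightarrow> a \<in> vars \<Gamma>"
  by (force simp: vars_def dest: map_of_SomeD)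

text \<open>\<open>map_of\<close> returns the first entry for a name while contexts grow at the end;
  freshness of \<open>a\<close> makes the new entry visible.\<close>

lemma map_of_snoc: "a \<notin> vars \<Gamma> \<Longrightarrow> map_of (\<Gamma> @ [(a, A)]) = (map_of \<Gamma>)(a \<mapsto> A)"
  by (rule ext) (auto simp: map_of_append map_add_def split: option.split dest: map_of_vars)

declare map_of_append [simp del]

lemma valid_vctx_snoc:
  "valid_vctx \<Sigma> \<Theta> (\<Gamma> @ [(a, A)]) \<longleftrightarrow>
    valid_vctx \<Sigma> \<Theta> \<Gamma> \<and> a \<notin> vars \<Gamma> \<and> valid_type \<Sigma> (marities \<Theta>) (vars \<Gamma>) 0 A"
  by (auto simp: valid_vctx_def less_Suc_eq nth_append vars_def)

lemma valid_vctx_map_of: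
  assumes "valid_vctx \<Sigma> \<Theta> \<Gamma>" "map_of \<Gamma> a = Some A"
  shows "valid_type \<Sigma> (marities \<Theta>) (vars \<Gamma>) 0 A"
proof -
  from assms(2) obtain i where i: "i < length \<Gamma>" "\<Gamma> ! i = (a, A)"
    by (metis map_of_SomeD in_set_conv_nth)
  have "vars (take i \<Gamma>) \<subseteq> vars \<Gamma>"
    by (auto simp: vars_def dest: in_set_takeD)
  with assms(1) i show ?thesis
    unfolding valid_vctx_def by (metis valid_expr_mono snd_conv)
qed

text \<open>This is the syntactic half of a substitution from \<open>\<Gamma>\<close> to
  \<open>\<Delta>\<close>, enough to preserve validity. \<open>renaming\<close> and
  \<open>typed_subst\<close> add the conditions on types.\<close>

definition valid_subst ::
    "'s signature \<Rightarrow> 's mctx \<Rightarrow> 's vctx \<Rightarrow> (var \<Rightarrow> 's expr) \<Rightarrow> 's vctx \<Rightarrow> bool" where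
  "valid_subst \<Sigma> \<Theta> \<Gamma> \<sigma> \<Delta> \<longleftrightarrow> term_subst \<sigma> \<and> valid_vctx \<Sigma> \<Theta> \<Delta> \<and>
    (\<forall>a \<in> vars \<Gamma>. valid_term \<Sigma> (marities \<Theta>) (vars \<Delta>) 0 (\<sigma> a))"

text \<open>Validity does not compare types, so the new variable of \<open>\<Delta>\<close> may be
  declared with any valid \<open>B\<close>, not only with the instance of \<open>A\<close>.\<close>

lemma valid_subst_lift:
  assumes "valid_subst \<Sigma> \<Theta> \<Gamma> \<sigma> \<Delta>" "valid_type \<Sigma> (marities \<Theta>) (vars \<Delta>) 0 B" "b \<notin> vars \<Delta>"
  shows "valid_subst \<Sigma> \<Theta> (\<Gamma> @ [(a, A)]) (\<sigma>(a := FVar b)) (\<Delta> @ [(b, B)])"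
  using assms unfolding valid_subst_def
  by (auto simp: valid_vctx_snoc term_subst_upd_FVar intro: valid_expr.intros valid_expr_mono)

lemma valid_hypothetical_fsubst:
  "valid_hypothetical \<Sigma> h \<Longrightarrow> valid_subst \<Sigma> (mctx_of h) (vctx_of h) \<sigma> \<Delta> \<Longrightarrow>
    valid_hypothetical \<Sigma> (fsubst_hyp \<Delta> \<sigma> h)"
  by (cases h) (auto simp: valid_subst_def intro: valid_judgement_fsubst valid_boundary_fsubst)

lemma fsubst_upd_fresh:
  "valid_expr \<Sigma> \<mu> V k c n e \<Longrightarrow> a \<notin> V \<Longrightarrow> fsubst (\<sigma>(a := t)) e = fsubst \<sigma> e"
  by (erule fsubst_cong_valid) auto

text \<open>As \<open>a\<close> does not occur in \<open>J\<close>, the update at \<open>a\<close>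
  is felt only at the opened index.\<close>

lemma fsubst_judgement_open:
  assumes "valid_judgement \<Sigma> \<mu> V k J" "a \<notin> V" "term_subst (\<sigma>(a := t))"
  shows "fsubst_judgement (\<sigma>(a := t)) (subst_judgement 0 (FVar a) J) =
    subst_judgement 0 t (fsubst_judgement \<sigma> J)"
proof -
  have "fsubst_judgement (\<sigma>(a := t)) J = fsubst_judgement \<sigma> J"
    using assms(1) by (rule fsubst_judgement_cong_valid) (use assms(2) in auto)
  then show ?thesis using assms(3) by (simp add: fsubst_judgement_subst)
qed

lemma fsubst_boundary_open:
  assumes "valid_boundary \<Sigma> \<mu> V k B" "a \<notin> V" "term_subst (\<sigma>(a := t))"
  shows "fsubst_boundary (\<sigma>(a := t)) (subst_boundary 0 (FVar a) B) =
    subst_boundary 0 t (fsubst_boundary \<sigma> B)"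
proof -
  have "fsubst_boundary (\<sigma>(a := t)) B = fsubst_boundary \<sigma> B"
    using assms(1) by (rule fsubst_boundary_cong_valid) (use assms(2) in auto)
  then show ?thesis using assms(3) by (simp add: fsubst_boundary_subst)
qed

text \<open>
  Passing under a binder extends the substitution by a variable in a weakened context. Abstracting
  over the class \<open>Q\<close> of substitutions lets the same induction serve first for renamings, which give
  weakening, and then for typed substitutions, whose extension needs weakening.
\<close>

lemma derivable_fsubst_class:
  fixes Q :: "'s mctx \<Rightarrow> 's vctx \<Rightarrow> (var \<Rightarrow> 's expr) \<Rightarrow> 's vctx \<Rightarrow> bool"
  assumes T: "raw_type_theory \<Sigma> T"
    and valid: "\<And>\<Theta> \<Gamma> \<sigma> \<Delta>. Q \<Theta> \<Gamma> \<sigma> \<Delta> \<Longrightarrow> valid_subst \<Sigma> \<Theta> \<Gamma> \<sigma> \<Delta>"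
    and var: "\<And>\<Theta> \<Gamma> \<sigma> \<Delta> a A. Q \<Theta> \<Gamma> \<sigma> \<Delta> \<Longrightarrow> valid_hypothetical \<Sigma> (HJ_thesis \<Theta> \<Delta> (HasType (\<sigma> a) (fsubst \<sigma> A)))
        \<Longrightarrow> map_of \<Gamma> a = Some A \<Longrightarrow> derivable \<Sigma> T (HJ_thesis \<Theta> \<Delta> (HasType (\<sigma> a) (fsubst \<sigma> A)))"
    and lift: "\<And>\<Theta> \<Gamma> \<sigma> \<Delta> a A b. Q \<Theta> \<Gamma> \<sigma> \<Delta> \<Longrightarrow> valid_mctx \<Sigma> \<Theta> \<Longrightarrow> valid_vctx \<Sigma> \<Theta> (\<Gamma> @ [(a, A)]) \<Longrightarrow>
        valid_vctx \<Sigma> \<Theta> (\<Delta> @ [(b, fsubst \<sigma> A)]) \<Longrightarrow>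
        Q \<Theta> (\<Gamma> @ [(a, A)]) (\<sigma>(a := FVar b)) (\<Delta> @ [(b, fsubst \<sigma> A)])"
    and h: "derivable \<Sigma> T h" and Q: "Q (mctx_of h) (vctx_of h) \<sigma> \<Delta>"
  shows "derivable \<Sigma> T (fsubst_hyp \<Delta> \<sigma> h)"
  using h Q
proof (induction arbitrary: \<sigma> \<Delta> rule: derivable.induct)
  case (1 P h)
  note wf = valid[OF 1(5)]
  have vh: "valid_hypothetical \<Sigma> (fsubst_hyp \<Delta> \<sigma> h)"
    using 1(3) wf by (rule valid_hypothetical_fsubst)
  have mctx: "valid_mctx \<Sigma> (mctx_of h)" using 1(3) by (cases h) auto
  have ts: "term_subst \<sigma>" using wf by (simp add: valid_subst_def)
  \<comment> \<open>The name chosen by an abstraction rule is fresh for the source context but may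
    occur in \<open>\<Delta>\<close>. The induction is general in \<open>\<sigma>\<close>, so that
    name can be sent to a different fresh \<open>b\<close>.\<close>
  obtain b where b: "b \<notin> vars \<Delta>" using fresh_var by blast
  have ext: "valid_vctx \<Sigma> (mctx_of h) (\<Delta> @ [(b, fsubst \<sigma> A)])"
    if "valid_type \<Sigma> (marities (mctx_of h)) (vars (vctx_of h)) 0 A" for A
    using wf b that by (auto simp: valid_subst_def valid_vctx_snoc intro: valid_expr_fsubst)
  from wf have "\<forall>a \<in> vars (vctx_of h). valid_term \<Sigma> (marities (mctx_of h)) (vars \<Delta>) 0 (\<sigma> a)"
    by (simp add: valid_subst_def)
  with 1(1) T mctx ts show ?case
  proof (cases rule: closure_rule_fsubst_cases)
    case (Var \<Theta> \<Gamma> a A)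
    then show ?thesis using var[of \<Theta> \<Gamma> \<sigma> \<Delta> a A] 1(5) vh by simp
  next
    case (Abstr \<Theta> \<Gamma> a A J)
    have IH: "Q \<Theta> \<Gamma> \<sigma> \<Delta> \<Longrightarrow> derivable \<Sigma> T (fsubst_hyp \<Delta> \<sigma> (HJ_thesis \<Theta> \<Gamma> (IsType A)))"
      "Q \<Theta> (\<Gamma> @ [(a, A)]) \<sigma> \<Delta> \<Longrightarrow>
        derivable \<Sigma> T (fsubst_hyp \<Delta> \<sigma> (HJ \<Theta> (\<Gamma> @ [(a, A)]) (subst_judgement 0 (FVar a) J)))" for \<sigma> \<Delta>
      using 1(4) unfolding Abstr(3) by simp_all
    have v: "valid_vctx \<Sigma> \<Theta> (\<Gamma> @ [(a, A)])" "valid_judgement \<Sigma> (marities \<Theta>) (vars \<Gamma>) 1 J"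
      "valid_type \<Sigma> (marities \<Theta>) (vars \<Gamma>) 0 A"
      using 1(3) Abstr by (auto simp: valid_vctx_snoc)
    have "Q \<Theta> (\<Gamma> @ [(a, A)]) (\<sigma>(a := FVar b)) (\<Delta> @ [(b, fsubst \<sigma> A)])"
      using lift[of \<Theta> \<Gamma> \<sigma> \<Delta> a A b] 1(5) mctx v ext Abstr by simp
    from IH(2)[OF this] have "derivable \<Sigma> T (HJ \<Theta> (\<Delta> @ [(b, fsubst \<sigma> A)]) (subst_judgement 0 (FVar b) (fsubst_judgement \<sigma> J)))"
      using fsubst_judgement_open[OF v(2) Abstr(2) term_subst_upd_FVar[OF ts, of a b]] by simp
    moreover have "derivable \<Sigma> T (HJ_thesis \<Theta> \<Delta> (IsType (fsubst \<sigma> A)))"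
      using IH(1)[of \<sigma> \<Delta>] 1(5) Abstr by simp
    ultimately show ?thesis
      using derivable_rule[OF closure_rule.Abstr[OF b]] vh Abstr by simp
  next
    case (Bdry_Abstr \<Theta> \<Gamma> a A B)
    have IH: "Q \<Theta> \<Gamma> \<sigma> \<Delta> \<Longrightarrow> derivable \<Sigma> T (fsubst_hyp \<Delta> \<sigma> (HJ_thesis \<Theta> \<Gamma> (IsType A)))"
      "Q \<Theta> (\<Gamma> @ [(a, A)]) \<sigma> \<Delta> \<Longrightarrow>
        derivable \<Sigma> T (fsubst_hyp \<Delta> \<sigma> (HB \<Theta> (\<Gamma> @ [(a, A)]) (subst_boundary 0 (FVar a) B)))" for \<sigma> \<Delta>
      using 1(4) unfolding Bdry_Abstr(3) by simp_all
    have v: "valid_vctx \<Sigma> \<Theta> (\<Gamma> @ [(a, A)])" "valid_boundary \<Sigma> (marities \<Theta>) (vars \<Gamma>) 1 B"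
      "valid_type \<Sigma> (marities \<Theta>) (vars \<Gamma>) 0 A"
      using 1(3) Bdry_Abstr by (auto simp: valid_vctx_snoc)
    have "Q \<Theta> (\<Gamma> @ [(a, A)]) (\<sigma>(a := FVar b)) (\<Delta> @ [(b, fsubst \<sigma> A)])"
      using lift[of \<Theta> \<Gamma> \<sigma> \<Delta> a A b] 1(5) mctx v ext Bdry_Abstr by simp
    from IH(2)[OF this] have "derivable \<Sigma> T (HB \<Theta> (\<Delta> @ [(b, fsubst \<sigma> A)]) (subst_boundary 0 (FVar b) (fsubst_boundary \<sigma> B)))"
      using fsubst_boundary_open[OF v(2) Bdry_Abstr(2) term_subst_upd_FVar[OF ts, of a b]] by simp
    moreover have "derivable \<Sigma> T (HJ_thesis \<Theta> \<Delta> (IsType (fsubst \<sigma> A)))"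
      using IH(1)[of \<sigma> \<Delta>] 1(5) Bdry_Abstr by simp
    ultimately show ?thesis
      using derivable_rule[OF closure_rule.Bdry_Abstr[OF b]] vh Bdry_Abstr by simp
  next
    case Local
    have "\<forall>p \<in> fsubst_hyp \<Delta> \<sigma> ` P. derivable \<Sigma> T p"
      using 1(4,5) Local(2) by auto
    with Local(1) show ?thesis using vh by (rule derivable_rule)
  qed
qed


section \<open>Renamings and weakening\<close>

lemma derivable_Var:
  assumes "valid_mctx \<Sigma> \<Theta>" "valid_vctx \<Sigma> \<Theta> \<Gamma>" "map_of \<Gamma> a = Some A"
  shows "derivable \<Sigma> T (HJ_thesis \<Theta> \<Gamma> (HasType (FVar a) A))"
proof (rule derivable_rule[OF closure_rule.Var[OF assms(3)]])
  show "valid_hypothetical \<Sigma> (HJ_thesis \<Theta> \<Gamma> (HasType (FVar a) A))"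
    using assms valid_vctx_map_of[OF assms(2,3)] by (auto intro: valid_expr.intros map_of_vars)
qed simp

text \<open>Types are matched by lookup and not by derivability, so a renaming can be extended under
  a binder before weakening is available.\<close>

definition renaming ::
    "'s signature \<Rightarrow> 's mctx \<Rightarrow> 's vctx \<Rightarrow> (var \<Rightarrow> 's expr) \<Rightarrow> 's vctx \<Rightarrow> bool" where
  "renaming \<Sigma> \<Theta> \<Gamma> \<sigma> \<Delta> \<longleftrightarrow> valid_subst \<Sigma> \<Theta> \<Gamma> \<sigma> \<Delta> \<and>
    (\<forall>a A. map_of \<Gamma> a = Some A \<longrightarrow> (\<exists>b. \<sigma> a = FVar b \<and> map_of \<Delta> b = Some (fsubst \<sigma> A)))"

text \<open>The types in \<open>\<Gamma>\<close> and \<open>A\<close> itself are valid over the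
  variables of \<open>\<Gamma>\<close>, among which \<open>a\<close> does not occur.\<close>

lemma fsubst_upd_vctx:
  assumes "valid_vctx \<Sigma> \<Theta> (\<Gamma> @ [(a, A)])"
  shows "map_of \<Gamma> x = Some B \<Longrightarrow> fsubst (\<sigma>(a := t)) B = fsubst \<sigma> B" "fsubst (\<sigma>(a := t)) A = fsubst \<sigma> A"
  using assms unfolding valid_vctx_snoc by (blast intro: fsubst_upd_fresh valid_vctx_map_of)+

lemma renaming_lift:
  assumes "renaming \<Sigma> \<Theta> \<Gamma> \<sigma> \<Delta>" and \<Gamma>: "valid_vctx \<Sigma> \<Theta> (\<Gamma> @ [(a, A)])"
    and \<Delta>: "valid_vctx \<Sigma> \<Theta> (\<Delta> @ [(b, fsubst \<sigma> A)])"
  shows "renaming \<Sigma> \<Theta> (\<Gamma> @ [(a, A)]) (\<sigma>(a := FVar b)) (\<Delta> @ [(b, fsubst \<sigma> A)])"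
  unfolding renaming_def
proof (intro conjI allI impI)
  show "valid_subst \<Sigma> \<Theta> (\<Gamma> @ [(a, A)]) (\<sigma>(a := FVar b)) (\<Delta> @ [(b, fsubst \<sigma> A)])"
    using assms by (intro valid_subst_lift) (auto simp: renaming_def valid_vctx_snoc)
next
  fix x B assume x: "map_of (\<Gamma> @ [(a, A)]) x = Some B"
  have a: "a \<notin> vars \<Gamma>" and b: "b \<notin> vars \<Delta>" using \<Gamma> \<Delta> by (auto simp: valid_vctx_snoc)
  show "\<exists>c. (\<sigma>(a := FVar b)) x = FVar c \<and>
    map_of (\<Delta> @ [(b, fsubst \<sigma> A)]) c = Some (fsubst (\<sigma>(a := FVar b)) B)"
  proof (cases "x = a")
    case True
    then show ?thesis using x a b fsubst_upd_vctx[OF \<Gamma>] by (auto simp: map_of_snoc)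
  next
    case False
    with x a have x': "map_of \<Gamma> x = Some B" by (simp add: map_of_snoc)
    with assms(1) obtain c where "\<sigma> x = FVar c" "map_of \<Delta> c = Some (fsubst \<sigma> B)"
      unfolding renaming_def by blast
    then show ?thesis
      using False b fsubst_upd_vctx[OF \<Gamma>] x' map_of_vars[of \<Delta> c] by (auto simp: map_of_snoc)
  qed
qed

lemma derivable_renaming:
  assumes T: "raw_type_theory \<Sigma> T" and "derivable \<Sigma> T h" "renaming \<Sigma> (mctx_of h) (vctx_of h) \<sigma> \<Delta>"
  shows "derivable \<Sigma> T (fsubst_hyp \<Delta> \<sigma> h)"
proof (rule derivable_fsubst_class[where Q = "renaming \<Sigma>", OF T _ _ _ assms(2,3)])
  show "renaming \<Sigma> \<Theta> \<Gamma> \<sigma> \<Delta> \<Longrightarrow> valid_subst \<Sigma> \<Theta> \<Gamma> \<sigma> \<Delta>" for \<Theta> \<Gamma> \<sigma> \<Delta>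
    by (simp add: renaming_def)
  show "derivable \<Sigma> T (HJ_thesis \<Theta> \<Delta> (HasType (\<sigma> a) (fsubst \<sigma> A)))"
    if "renaming \<Sigma> \<Theta> \<Gamma> \<sigma> \<Delta>" "valid_hypothetical \<Sigma> (HJ_thesis \<Theta> \<Delta> (HasType (\<sigma> a) (fsubst \<sigma> A)))"
      "map_of \<Gamma> a = Some A" for \<Theta> \<Gamma> \<sigma> \<Delta> a A
  proof -
    from that(1,3) obtain b where "\<sigma> a = FVar b" "map_of \<Delta> b = Some (fsubst \<sigma> A)"
      unfolding renaming_def by blast
    with that(2) show ?thesis by (auto intro: derivable_Var)
  qed
qed (rule renaming_lift)

text \<open>The identity is a renaming into the longer context, since the fresh entry at the end
  hides no earlier one.\<close>

lemma derivable_weakening: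
  assumes T: "raw_type_theory \<Sigma> T" and J: "derivable \<Sigma> T (HJ \<Theta> \<Gamma> J)"
    and B: "valid_vctx \<Sigma> \<Theta> (\<Gamma> @ [(b, B)])"
  shows "derivable \<Sigma> T (HJ \<Theta> (\<Gamma> @ [(b, B)]) J)"
proof -
  have "map_of (\<Gamma> @ [(b, B)]) a = Some A" if "map_of \<Gamma> a = Some A" for a A
    using B that map_of_vars[OF that] by (auto simp: valid_vctx_snoc map_of_snoc)
  then have "renaming \<Sigma> \<Theta> \<Gamma> FVar (\<Gamma> @ [(b, B)])"
    using B by (auto simp: renaming_def valid_subst_def term_subst_FVar intro: valid_expr.intros)
  with derivable_renaming[OF T J, of FVar "\<Gamma> @ [(b, B)]"] show ?thesis by simp
qed

section \<open>Typed substitutions\<close>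

definition typed_subst ::
    "'s signature \<Rightarrow> 's raw_rule set \<Rightarrow> 's mctx \<Rightarrow> 's vctx \<Rightarrow> (var \<Rightarrow> 's expr) \<Rightarrow> 's vctx \<Rightarrow> bool" where
  "typed_subst \<Sigma> T \<Theta> \<Gamma> \<sigma> \<Delta> \<longleftrightarrow> valid_subst \<Sigma> \<Theta> \<Gamma> \<sigma> \<Delta> \<and>
    (\<forall>a A. map_of \<Gamma> a = Some A \<longrightarrow> derivable \<Sigma> T (HJ_thesis \<Theta> \<Delta> (HasType (\<sigma> a) (fsubst \<sigma> A))))"

text \<open>The declared type \<open>B\<close> need not be \<open>fsubst \<sigma> A\<close>; it
  suffices that \<open>b\<close> can be given that type. This freedom serves the second of two equal
  substitutions, whose binder is typed by the first, and the change of a binder type by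
  conversion.\<close>

lemma typed_subst_lift:
  assumes T: "raw_type_theory \<Sigma> T" and "typed_subst \<Sigma> T \<Theta> \<Gamma> \<sigma> \<Delta>"
    and \<Gamma>: "valid_vctx \<Sigma> \<Theta> (\<Gamma> @ [(a, A)])" and \<Delta>: "valid_vctx \<Sigma> \<Theta> (\<Delta> @ [(b, B)])"
    and b: "derivable \<Sigma> T (HJ_thesis \<Theta> (\<Delta> @ [(b, B)]) (HasType (FVar b) (fsubst \<sigma> A)))"
  shows "typed_subst \<Sigma> T \<Theta> (\<Gamma> @ [(a, A)]) (\<sigma>(a := FVar b)) (\<Delta> @ [(b, B)])"
  unfolding typed_subst_def
proof (intro conjI allI impI)
  show "valid_subst \<Sigma> \<Theta> (\<Gamma> @ [(a, A)]) (\<sigma>(a := FVar b)) (\<Delta> @ [(b, B)])"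
    using assms by (intro valid_subst_lift) (auto simp: typed_subst_def valid_vctx_snoc)
next
  fix x C assume x: "map_of (\<Gamma> @ [(a, A)]) x = Some C"
  have a: "a \<notin> vars \<Gamma>" using \<Gamma> by (auto simp: valid_vctx_snoc)
  show "derivable \<Sigma> T (HJ_thesis \<Theta> (\<Delta> @ [(b, B)])
      (HasType ((\<sigma>(a := FVar b)) x) (fsubst (\<sigma>(a := FVar b)) C)))"
  proof (cases "x = a")
    case True
    then show ?thesis using x a b fsubst_upd_vctx[OF \<Gamma>] by (simp add: map_of_snoc)
  next
    case False
    with x a have x': "map_of \<Gamma> x = Some C" by (simp add: map_of_snoc)
    with assms(2) have "derivable \<Sigma> T (HJ_thesis \<Theta> \<Delta> (HasType (\<sigma> x) (fsubst \<sigma> C)))"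
      unfolding typed_subst_def by blast
    from derivable_weakening[OF T this \<Delta>] show ?thesis
      using False fsubst_upd_vctx[OF \<Gamma>] x' by simp
  qed
qed

lemma derivable_fsubst:
  assumes T: "raw_type_theory \<Sigma> T" and "derivable \<Sigma> T h" "typed_subst \<Sigma> T (mctx_of h) (vctx_of h) \<sigma> \<Delta>"
  shows "derivable \<Sigma> T (fsubst_hyp \<Delta> \<sigma> h)"
proof (rule derivable_fsubst_class[where Q = "typed_subst \<Sigma> T", OF T _ _ _ assms(2,3)])
  show "typed_subst \<Sigma> T \<Theta> (\<Gamma> @ [(a, A)]) (\<sigma>(a := FVar b)) (\<Delta> @ [(b, fsubst \<sigma> A)])"
    if "typed_subst \<Sigma> T \<Theta> \<Gamma> \<sigma> \<Delta>" "valid_mctx \<Sigma> \<Theta>" "valid_vctx \<Sigma> \<Theta> (\<Gamma> @ [(a, A)])"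
      "valid_vctx \<Sigma> \<Theta> (\<Delta> @ [(b, fsubst \<sigma> A)])" for \<Theta> \<Gamma> \<sigma> \<Delta> a A b
  proof (rule typed_subst_lift[OF T that(1,3,4)])
    show "derivable \<Sigma> T (HJ_thesis \<Theta> (\<Delta> @ [(b, fsubst \<sigma> A)]) (HasType (FVar b) (fsubst \<sigma> A)))"
      using that by (intro derivable_Var) (auto simp: valid_vctx_snoc map_of_snoc)
  qed
qed (auto simp: typed_subst_def)

section \<open>Admissibility of equal substitutions\<close>

text \<open>
  On object judgements this is the equation between the two substitution instances; equations, which
  have no such instance, are just substituted, so that the abstraction rule can be treated uniformly.
\<close>

primrec eq_thesis :: "(var \<Rightarrow> 's expr) \<Rightarrow> (var \<Rightarrow> 's expr) \<Rightarrow> 's expr judgement \<Rightarrow> 's expr judgement" where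
  "eq_thesis \<sigma> \<tau> (IsType A) = EqType (fsubst \<sigma> A) (fsubst \<tau> A)"
| "eq_thesis \<sigma> \<tau> (HasType t A) = EqTerm (fsubst \<sigma> t) (fsubst \<tau> t) (fsubst \<sigma> A)"
| "eq_thesis \<sigma> \<tau> (EqType A B) = EqType (fsubst \<sigma> A) (fsubst \<sigma> B)"
| "eq_thesis \<sigma> \<tau> (EqTerm s t A) = EqTerm (fsubst \<sigma> s) (fsubst \<sigma> t) (fsubst \<sigma> A)"

abbreviation eq_judgement :: "(var \<Rightarrow> 's expr) \<Rightarrow> (var \<Rightarrow> 's expr) \<Rightarrow> 's ajudgement \<Rightarrow> 's ajudgement" where
  "eq_judgement \<sigma> \<tau> \<equiv> map_abstracted (fsubst \<sigma>) (eq_thesis \<sigma> \<tau>)"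

definition eq_subst ::
    "'s signature \<Rightarrow> 's raw_rule set \<Rightarrow> 's mctx \<Rightarrow> 's vctx \<Rightarrow> (var \<Rightarrow> 's expr) \<Rightarrow> (var \<Rightarrow> 's expr) \<Rightarrow>
      's vctx \<Rightarrow> bool" where
  "eq_subst \<Sigma> T \<Theta> \<Gamma> \<sigma> \<tau> \<Delta> \<longleftrightarrow> typed_subst \<Sigma> T \<Theta> \<Gamma> \<sigma> \<Delta> \<and> typed_subst \<Sigma> T \<Theta> \<Gamma> \<tau> \<Delta> \<and>
    (\<forall>a A. map_of \<Gamma> a = Some A \<longrightarrow> derivable \<Sigma> T (HJ_thesis \<Theta> \<Delta> (EqTerm (\<sigma> a) (\<tau> a) (fsubst \<sigma> A))))"

lemma valid_eq_judgement:
  assumes "valid_judgement \<Sigma> \<mu> V k J" "\<And>a. a \<in> V \<Longrightarrow> valid_term \<Sigma> \<mu> W 0 (\<sigma> a)"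
    "\<And>a. a \<in> V \<Longrightarrow> valid_term \<Sigma> \<mu> W 0 (\<tau> a)"
  shows "valid_judgement \<Sigma> \<mu> W k (eq_judgement \<sigma> \<tau> J)"
  using assms(1)
proof (induction J arbitrary: k)
  case (Thesis j)
  then show ?case by (cases j) (auto intro: valid_expr_fsubst assms(2,3))
qed (auto intro: valid_expr_fsubst assms(2,3))

lemma eq_judgement_cong_valid:
  assumes "valid_judgement \<Sigma> \<mu> V k J" "\<And>a. a \<in> V \<Longrightarrow> \<sigma> a = \<sigma>' a" "\<And>a. a \<in> V \<Longrightarrow> \<tau> a = \<tau>' a"
  shows "eq_judgement \<sigma> \<tau> J = eq_judgement \<sigma>' \<tau>' J"
  using assms(1)
proof (induction J arbitrary: k)
  case (Thesis j)
  then show ?case by (cases j) (auto intro: fsubst_cong_valid assms(2,3))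
qed (auto intro: fsubst_cong_valid assms(2,3))

text \<open>The right side inserts a single term everywhere, hence the two instances of
  \<open>t\<close> have to coincide. This holds for an opened variable that both substitutions send
  to the same fresh name.\<close>

lemma eq_judgement_subst:
  assumes "term_subst \<sigma>" "term_subst \<tau>" "fsubst \<sigma> t = fsubst \<tau> t"
  shows "eq_judgement \<sigma> \<tau> (subst_judgement k t J) = subst_judgement k (fsubst \<sigma> t) (eq_judgement \<sigma> \<tau> J)"
proof (induction J arbitrary: k)
  case (Thesis j)
  then show ?case using assms by (cases j) (auto simp: fsubst_subst)
qed (use assms in \<open>auto simp: fsubst_subst\<close>)

text \<open>\<open>\<tau>\<close> enters only through the head, while the boundary takes its
  \<open>\<sigma>\<close>-instance. This is the shape of the equational premises of a congruence
  rule, whose boundaries use the first instantiation.\<close>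

lemma eq_fill:
  "valid_expr \<Sigma> \<mu> V k c n e \<Longrightarrow> arity_of B = (c, n) \<Longrightarrow> object_boundary B \<Longrightarrow>
    eq_judgement \<sigma> \<tau> (fill B e) = fill_eq (fsubst_boundary \<sigma> B) (fsubst \<sigma> e) (fsubst \<tau> e)"
proof (induction B arbitrary: k n e)
  case (Thesis b)
  then show ?case by (cases b) (auto simp: object_boundary_def)
next
  case (Bind A B)
  then obtain n' where n: "n = Suc n'" "arity_of B = (c, n')"
    by (auto split: prod.splits)
  with Bind.prems obtain e' where "e = Abs e'" "valid_expr \<Sigma> \<mu> V (Suc k) c n' e'"
    by (auto elim: valid_expr_SucE)
  with Bind.IH[of "Suc k" n' e'] Bind.prems n show ?case by (auto simp: object_boundary_def)
qed

lemma eq_subst_lift: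
  assumes T: "raw_type_theory \<Sigma> T" and E: "eq_subst \<Sigma> T \<Theta> \<Gamma> \<sigma> \<tau> \<Delta>"
    and \<Gamma>: "valid_vctx \<Sigma> \<Theta> (\<Gamma> @ [(a, A)])" and \<Delta>: "valid_vctx \<Sigma> \<Theta> (\<Delta> @ [(b, fsubst \<sigma> A)])"
    and A: "derivable \<Sigma> T (HJ_thesis \<Theta> \<Delta> (EqType (fsubst \<sigma> A) (fsubst \<tau> A)))"
  shows "eq_subst \<Sigma> T \<Theta> (\<Gamma> @ [(a, A)]) (\<sigma>(a := FVar b)) (\<tau>(a := FVar b)) (\<Delta> @ [(b, fsubst \<sigma> A)])"
proof -
  let ?\<Delta> = "\<Delta> @ [(b, fsubst \<sigma> A)]"
  have a: "a \<notin> vars \<Gamma>" and b: "b \<notin> vars \<Delta>" using \<Gamma> \<Delta> by (auto simp: valid_vctx_snoc)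
  have b\<sigma>: "derivable \<Sigma> T (HJ_thesis \<Theta> ?\<Delta> (HasType (FVar b) (fsubst \<sigma> A)))"
    using derivable_valid[OF A] \<Delta> b by (intro derivable_Var) (auto simp: map_of_snoc)
  have A': "derivable \<Sigma> T (HJ_thesis \<Theta> ?\<Delta> (EqType (fsubst \<sigma> A) (fsubst \<tau> A)))"
    by (rule derivable_weakening[OF T A \<Delta>])
  have b\<tau>: "derivable \<Sigma> T (HJ_thesis \<Theta> ?\<Delta> (HasType (FVar b) (fsubst \<tau> A)))"
    by (rule derivable_rule[OF closure_rule.Conv_Tm])
      (use b\<sigma> A' derivable_valid[OF A'] derivable_valid[OF b\<sigma>] in auto)
  have bb: "derivable \<Sigma> T (HJ_thesis \<Theta> ?\<Delta> (EqTerm (FVar b) (FVar b) (fsubst \<sigma> A)))"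
    by (rule derivable_rule[OF closure_rule.EqTm_Refl]) (use b\<sigma> derivable_valid[OF b\<sigma>] in auto)
  have "derivable \<Sigma> T (HJ_thesis \<Theta> ?\<Delta> (EqTerm ((\<sigma>(a := FVar b)) x) ((\<tau>(a := FVar b)) x)
      (fsubst (\<sigma>(a := FVar b)) C)))" if x: "map_of (\<Gamma> @ [(a, A)]) x = Some C" for x C
  proof (cases "x = a")
    case True
    then show ?thesis using x a bb fsubst_upd_vctx[OF \<Gamma>] by (simp add: map_of_snoc)
  next
    case False
    with x a have x': "map_of \<Gamma> x = Some C" by (simp add: map_of_snoc)
    with E have "derivable \<Sigma> T (HJ_thesis \<Theta> \<Delta> (EqTerm (\<sigma> x) (\<tau> x) (fsubst \<sigma> C)))"
      unfolding eq_subst_def by blast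
    from derivable_weakening[OF T this \<Delta>] show ?thesis
      using False fsubst_upd_vctx[OF \<Gamma>] x' by simp
  qed
  with E b\<sigma> b\<tau> show ?thesis
    unfolding eq_subst_def by (blast intro: typed_subst_lift[OF T _ \<Gamma> \<Delta>])
qed


text \<open>
  The clause for boundaries provides the type equation that the congruence rules for terms require
  as an extra premise.
\<close>

primrec eq_derivable ::
    "'s signature \<Rightarrow> 's raw_rule set \<Rightarrow> (var \<Rightarrow> 's expr) \<Rightarrow> (var \<Rightarrow> 's expr) \<Rightarrow> 's vctx \<Rightarrow>
      's hypothetical \<Rightarrow> bool" where
  "eq_derivable \<Sigma> T \<sigma> \<tau> \<Delta> (HJ \<Theta> \<Gamma> J) \<longleftrightarrow> derivable \<Sigma> T (HJ \<Theta> \<Delta> (eq_judgement \<sigma> \<tau> J))"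
| "eq_derivable \<Sigma> T \<sigma> \<tau> \<Delta> (HB \<Theta> \<Gamma> B) \<longleftrightarrow> (\<forall>A. B = Thesis (BTm A) \<longrightarrow>
    derivable \<Sigma> T (HJ_thesis \<Theta> \<Delta> (EqType (fsubst \<sigma> A) (fsubst \<tau> A))))"

text \<open>The last hypothesis is what induction provides for the typing premises of a metavariable
  application. The resulting equations have the required types because every \<open>As ! j\<close>
  is fixed by \<open>\<sigma>\<close>.\<close>

lemma arg_eq_premises_derivable:
  assumes "term_subst \<sigma>" "length ts = length As" "\<And>j. j < length As \<Longrightarrow> fsubst \<sigma> (As ! j) = As ! j"
    "\<forall>p \<in> arg_premises \<Theta> \<Gamma> As ts. eq_derivable \<Sigma> T \<sigma> \<tau> \<Delta> p"
  shows "\<forall>p \<in> arg_eq_premises \<Theta> \<Delta> As (map (fsubst \<sigma>) ts) (map (fsubst \<tau>) ts). derivable \<Sigma> T p"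
proof
  fix p assume "p \<in> arg_eq_premises \<Theta> \<Delta> As (map (fsubst \<sigma>) ts) (map (fsubst \<tau>) ts)"
  then obtain j where j: "j < length As" and
    p: "p = HJ_thesis \<Theta> \<Delta> (EqTerm (fsubst \<sigma> (ts ! j)) (fsubst \<tau> (ts ! j))
      (subst 0 (map (fsubst \<sigma>) (take j ts)) (As ! j)))"
    using assms(2) by (auto simp: arg_eq_premises_def take_map)
  have "HJ_thesis \<Theta> \<Gamma> (HasType (ts ! j) (subst 0 (take j ts) (As ! j))) \<in> arg_premises \<Theta> \<Gamma> As ts"
    using j by (auto simp: arg_premises_def)
  with assms(4) show "derivable \<Sigma> T p"
    using assms(1,3) j by (fastforce simp: p fsubst_subst)
qed

text \<open>This is the analogue for specific rules: on object boundaries \<open>eq_fill\<close>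
  turns the induction hypothesis for a rule premise into the corresponding equational
  premise.\<close>

lemma rule_eq_premises_derivable:
  assumes "term_subst \<sigma>" "valid_mctx \<Sigma> \<Xi>" and I: "instantiates \<Sigma> \<Theta> \<Gamma> \<Xi> I"
    and "\<forall>p \<in> rule_premises \<Theta> \<Gamma> \<Xi> I. eq_derivable \<Sigma> T \<sigma> \<tau> \<Delta> p"
  shows "\<forall>p \<in> rule_eq_premises \<Theta> \<Delta> \<Xi> (fsubst_minst \<sigma> I) (fsubst_minst \<tau> I). derivable \<Sigma> T p"
proof
  fix p assume "p \<in> rule_eq_premises \<Theta> \<Delta> \<Xi> (fsubst_minst \<sigma> I) (fsubst_minst \<tau> I)"
  then obtain i where i: "i < length \<Xi>" and ob: "object_boundary (snd (\<Xi> ! i))" and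
    p: "p = HJ \<Theta> \<Delta> (fill_eq (act_boundary (fsubst_minst \<sigma> (take i I)) (snd (\<Xi> ! i)))
      (fsubst \<sigma> (snd (I ! i))) (fsubst \<tau> (snd (I ! i))))"
    using instantiates_length[OF I]
    by (auto simp: rule_eq_premises_def take_fsubst_minst nth_fsubst_minst)
  let ?B = "act_boundary (take i I) (snd (\<Xi> ! i))"
  obtain c n where ar: "arity_of (snd (\<Xi> ! i)) = (c, n)" by fastforce
  from valid_mctx_nth[OF assms(2) i] obtain \<mu> where "valid_boundary \<Sigma> \<mu> {} 0 (snd (\<Xi> ! i))" ..
  from fsubst_boundary_act_closed[OF this assms(1), of "take i I"]
  have "eq_judgement \<sigma> \<tau> (fill ?B (snd (I ! i))) =
      fill_eq (act_boundary (fsubst_minst \<sigma> (take i I)) (snd (\<Xi> ! i)))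
        (fsubst \<sigma> (snd (I ! i))) (fsubst \<tau> (snd (I ! i)))"
    using eq_fill[OF instantiates_nth[OF I i ar], of ?B \<sigma> \<tau>] ar ob by (simp add: object_boundary_def)
  moreover have "HJ \<Theta> \<Gamma> (fill ?B (snd (I ! i))) \<in> rule_premises \<Theta> \<Gamma> \<Xi> I"
    using i by (auto simp: rule_premises_def)
  ultimately show "derivable \<Sigma> T p"
    using assms(4) p by force
qed

lemma derivable_eq_fsubst:
  assumes T: "raw_type_theory \<Sigma> T" and "derivable \<Sigma> T h" "eq_subst \<Sigma> T (mctx_of h) (vctx_of h) \<sigma> \<tau> \<Delta>"
  shows "eq_derivable \<Sigma> T \<sigma> \<tau> \<Delta> h"
  using assms(2,3)
proof (induction arbitrary: \<sigma> \<tau> \<Delta> rule: derivable.induct)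
  case (1 P h)
  have typed: "typed_subst \<Sigma> T (mctx_of h) (vctx_of h) \<sigma> \<Delta>" "typed_subst \<Sigma> T (mctx_of h) (vctx_of h) \<tau> \<Delta>"
    using 1(5) by (auto simp: eq_subst_def)
  have ts: "term_subst \<sigma>" "term_subst \<tau>" and valid\<Delta>: "valid_vctx \<Sigma> (mctx_of h) \<Delta>"
    and vt: "\<And>a. a \<in> vars (vctx_of h) \<Longrightarrow> valid_term \<Sigma> (marities (mctx_of h)) (vars \<Delta>) 0 (\<sigma> a)"
    "\<And>a. a \<in> vars (vctx_of h) \<Longrightarrow> valid_term \<Sigma> (marities (mctx_of h)) (vars \<Delta>) 0 (\<tau> a)"
    using typed by (auto simp: typed_subst_def valid_subst_def)
  have mctx: "valid_mctx \<Sigma> (mctx_of h)" using 1(3) by (cases h) auto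
  have valid: "valid_hypothetical \<Sigma> (HJ \<Theta> \<Delta> (eq_judgement \<sigma> \<tau> J))" if "h = HJ \<Theta> \<Gamma> J" for \<Theta> \<Gamma> J
    using 1(3) valid\<Delta> vt that by (auto intro: valid_eq_judgement)
  \<comment> \<open>A premise in the same contexts yields three facts: its two instances by
    admissibility of substitution, and their equation by the induction hypothesis.\<close>
  have prem: "derivable \<Sigma> T (fsubst_hyp \<Delta> \<sigma> p)" "derivable \<Sigma> T (fsubst_hyp \<Delta> \<tau> p)"
    "eq_derivable \<Sigma> T \<sigma> \<tau> \<Delta> p"
    if "p \<in> P" "mctx_of p = mctx_of h" "vctx_of p = vctx_of h" for p
    using 1(4,5) that typed derivable_fsubst[OF T, of p] by auto
  \<comment> \<open>For equations \<open>eq_thesis\<close> is substitution by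
    \<open>\<sigma>\<close>, so the \<open>\<sigma>\<close>-instance of \<open>h\<close> settles
    every rule that concludes one. For boundaries other than \<open>BTm\<close> nothing is
    claimed.\<close>
  have "derivable \<Sigma> T h" using 1(1-4) by (intro derivable.intros[OF 1(1)]) auto
  from derivable_fsubst[OF T this typed(1)] have h: "derivable \<Sigma> T (fsubst_hyp \<Delta> \<sigma> h)" .
  from 1(1) show ?case
  proof cases
    case (Var \<Gamma> a A \<Theta>)
    then show ?thesis using 1(5) by (simp add: eq_subst_def)
  next
    case (Meta \<Theta> M As b us \<Gamma>)
    note closed = meta_closed[OF _ Meta(3), where \<Sigma> = \<Sigma>]
    have m: "valid_mctx \<Sigma> \<Theta>" using mctx Meta by simp
    have arg: "p \<in> P \<and> mctx_of p = mctx_of h \<and> vctx_of p = vctx_of h" if "p \<in> arg_premises \<Theta> \<Gamma> As us" for p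
      using that Meta by (auto simp: arg_premises_def)
    have args: "\<forall>p \<in> arg_premises \<Theta> \<Delta> As (map (fsubst \<sigma>) us). derivable \<Sigma> T p"
      "\<forall>p \<in> arg_premises \<Theta> \<Delta> As (map (fsubst \<tau>) us). derivable \<Sigma> T p"
      using arg prem Meta(4) ts closed[OF m] by (auto simp: arg_premises_fsubst[where \<Gamma> = \<Gamma>])
    have eqs: "\<forall>p \<in> arg_eq_premises \<Theta> \<Delta> As (map (fsubst \<sigma>) us) (map (fsubst \<tau>) us). derivable \<Sigma> T p"
      using arg prem Meta(4) ts closed[OF m] by (intro arg_eq_premises_derivable[where \<Gamma> = \<Gamma>]) auto
    show ?thesis
    \<comment> \<open>An object boundary calls for the matching congruence rule; for an equation
      boundary the \<open>\<sigma>\<close>-instance of the conclusion is already the goal.\<close>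
    proof (cases b)
      case BTy
      show ?thesis
        using derivable_rule[OF closure_rule.Meta_Congr_Ty[OF Meta(3)[unfolded BTy], of "map (fsubst \<sigma>) us"
              "map (fsubst \<tau>) us" \<Sigma> T \<Delta>]] args eqs valid[OF Meta(2)] Meta BTy
        by (auto simp: Ball_def)
    next
      case (BTm C)
      have C: "fsubst \<sigma> C = C" "fsubst \<tau> C = C" using closed(2)[OF m] BTm by auto
      have "derivable \<Sigma> T (HJ_thesis \<Theta> \<Delta> (EqType (subst 0 (map (fsubst \<sigma>) us) C) (subst 0 (map (fsubst \<tau>) us) C)))"
        using prem(3)[of "HB_thesis \<Theta> \<Gamma> (map_boundary (subst 0 us) b)"] Meta BTm ts C by (simp add: fsubst_subst)
      then show ?thesis
        using derivable_rule[OF closure_rule.Meta_Congr_Tm[OF Meta(3)[unfolded BTm], of "map (fsubst \<sigma>) us"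
              "map (fsubst \<tau>) us" \<Sigma> T \<Delta>]] args eqs valid[OF Meta(2)] Meta BTm C ts
        by (auto simp: Ball_def fsubst_subst)
    qed (use h Meta in auto)
  next
    case (Abstr a \<Gamma> \<Theta> A J)
    obtain b where b: "b \<notin> vars \<Delta>" using fresh_var by blast
    have A: "derivable \<Sigma> T (HJ_thesis \<Theta> \<Delta> (EqType (fsubst \<sigma> A) (fsubst \<tau> A)))"
      "derivable \<Sigma> T (HJ_thesis \<Theta> \<Delta> (IsType (fsubst \<sigma> A)))"
      using prem(1,3)[of "HJ_thesis \<Theta> \<Gamma> (IsType A)"] Abstr by auto
    have v: "valid_vctx \<Sigma> \<Theta> (\<Gamma> @ [(a, A)])" "valid_judgement \<Sigma> (marities \<Theta>) (vars \<Gamma>) 1 J"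
      using 1(3) Abstr by (auto simp: valid_vctx_snoc)
    have v\<Delta>: "valid_vctx \<Sigma> \<Theta> (\<Delta> @ [(b, fsubst \<sigma> A)])"
      using derivable_valid[OF A(2)] b by (simp add: valid_vctx_snoc)
    \<comment> \<open>The target is extended by the \<open>\<sigma>\<close>-instance of
      \<open>A\<close> because \<open>eq_judgement\<close> instantiates binder types by
      \<open>\<sigma>\<close>.\<close>
    have "eq_subst \<Sigma> T \<Theta> (\<Gamma> @ [(a, A)]) (\<sigma>(a := FVar b)) (\<tau>(a := FVar b)) (\<Delta> @ [(b, fsubst \<sigma> A)])"
      using eq_subst_lift[OF T _ v(1) v\<Delta> A(1)] 1(5) Abstr by simp
    then have "derivable \<Sigma> T (HJ \<Theta> (\<Delta> @ [(b, fsubst \<sigma> A)])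
        (eq_judgement (\<sigma>(a := FVar b)) (\<tau>(a := FVar b)) (subst_judgement 0 (FVar a) J)))"
      using 1(4) unfolding Abstr(1) by (metis insertI1 insertI2 eq_derivable.simps(1) mctx_of.simps(1) vctx_of.simps(1))
    moreover have "eq_judgement (\<sigma>(a := FVar b)) (\<tau>(a := FVar b)) J = eq_judgement \<sigma> \<tau> J"
      using v(2) by (rule eq_judgement_cong_valid) (use Abstr(3) in auto)
    then have "eq_judgement (\<sigma>(a := FVar b)) (\<tau>(a := FVar b)) (subst_judgement 0 (FVar a) J) =
        subst_judgement 0 (FVar b) (eq_judgement \<sigma> \<tau> J)"
      using eq_judgement_subst[of "\<sigma>(a := FVar b)" "\<tau>(a := FVar b)" "FVar a"] ts
      by (simp add: term_subst_upd_FVar)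
    ultimately show ?thesis
      using derivable_rule[OF closure_rule.Abstr[OF b]] A valid[OF Abstr(2)] Abstr by simp
  next
    case (Conv_Tm \<Theta> \<Gamma> t A B)
    \<comment> \<open>The equation is obtained at the \<open>\<sigma>\<close>-instance of
      \<open>A\<close> and moved to that of \<open>B\<close> along the
      \<open>\<sigma>\<close>-instance of the type equation.\<close>
    have "derivable \<Sigma> T (HJ_thesis \<Theta> \<Delta> (EqTerm (fsubst \<sigma> t) (fsubst \<tau> t) (fsubst \<sigma> A)))"
      "derivable \<Sigma> T (HJ_thesis \<Theta> \<Delta> (EqType (fsubst \<sigma> A) (fsubst \<sigma> B)))"
      using prem(3)[of "HJ_thesis \<Theta> \<Gamma> (HasType t A)"] prem(1)[of "HJ_thesis \<Theta> \<Gamma> (EqType A B)"] Conv_Tm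
      by auto
    then show ?thesis
      using derivable_rule[OF closure_rule.Conv_EqTm[where A = "fsubst \<sigma> A"]] valid[OF Conv_Tm(2)] Conv_Tm
      by simp
  next
    case (Bdry_Tm \<Theta> \<Gamma> A)
    then show ?thesis using prem(3)[of "HJ_thesis \<Theta> \<Gamma> (IsType A)"] by auto
  next
    case (Specific \<Xi> j \<Theta> \<Gamma> I)
    note rule = raw_rule_closed[OF T Specific(3)]
    have inst: "instantiates \<Sigma> \<Theta> \<Delta> \<Xi> (fsubst_minst \<sigma> I)" "instantiates \<Sigma> \<Theta> \<Delta> \<Xi> (fsubst_minst \<tau> I)"
      using instantiates_fsubst[OF Specific(4)] vt Specific by auto
    have pre: "p \<in> P \<and> mctx_of p = mctx_of h \<and> vctx_of p = vctx_of h" if "p \<in> rule_premises \<Theta> \<Gamma> \<Xi> I" for p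
      using that Specific by (auto simp: rule_premises_def)
    have pres: "\<forall>p \<in> rule_premises \<Theta> \<Delta> \<Xi> (fsubst_minst \<sigma> I). derivable \<Sigma> T p"
      "\<forall>p \<in> rule_premises \<Theta> \<Delta> \<Xi> (fsubst_minst \<tau> I). derivable \<Sigma> T p"
      using pre prem ts rule(1) Specific(4) by (auto simp: rule_premises_fsubst)
    have eqs: "\<forall>p \<in> rule_eq_premises \<Theta> \<Delta> \<Xi> (fsubst_minst \<sigma> I) (fsubst_minst \<tau> I). derivable \<Sigma> T p"
      using pre prem(3) by (intro rule_eq_premises_derivable[OF ts(1) rule(1) Specific(4)]) auto
    show ?thesis
    proof (cases j)
      case (IsType A)
      have act: "fsubst \<sigma> (act I A) = act (fsubst_minst \<sigma> I) A" "fsubst \<tau> (act I A) = act (fsubst_minst \<tau> I) A"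
        using rule(2) IsType ts by (auto intro: fsubst_act_closed)
      show ?thesis
        using derivable_rule[OF closure_rule.Specific_Congr_Ty[OF Specific(3)[unfolded IsType] inst]]
          pres eqs valid[OF Specific(2)] Specific IsType act
        by (auto simp: Ball_def)
    next
      case (HasType t A)
      have act: "fsubst \<sigma> (act I A) = act (fsubst_minst \<sigma> I) A" "fsubst \<tau> (act I A) = act (fsubst_minst \<tau> I) A"
        "fsubst \<sigma> (act I t) = act (fsubst_minst \<sigma> I) t" "fsubst \<tau> (act I t) = act (fsubst_minst \<tau> I) t"
        using rule(2) HasType ts by (auto intro: fsubst_act_closed)
      have "derivable \<Sigma> T (HJ_thesis \<Theta> \<Delta> (EqType (act (fsubst_minst \<sigma> I) A) (act (fsubst_minst \<tau> I) A)))"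
        using prem(3)[of "HB_thesis \<Theta> \<Gamma> (map_boundary (act I) (boundary_of j))"] Specific HasType act by simp
      then show ?thesis
        using derivable_rule[OF closure_rule.Specific_Congr_Tm[OF Specific(3)[unfolded HasType] inst]]
          pres eqs valid[OF Specific(2)] Specific HasType act
        by (auto simp: Ball_def)
    qed (use h Specific in auto)
  qed (use h in auto)
qed

section \<open>The closure rules\<close>

text \<open>Every closure rule for judgements except \<open>Abstr\<close> concludes an unabstracted
  one, so inversion leaves a single case.\<close>

lemma derivable_BindE:
  assumes "derivable \<Sigma> T (HJ \<Theta> \<Gamma> (Bind A J))"
  obtains a where "a \<notin> vars \<Gamma>" "derivable \<Sigma> T (HJ_thesis \<Theta> \<Gamma> (IsType A))"
    "derivable \<Sigma> T (HJ \<Theta> (\<Gamma> @ [(a, A)]) (subst_judgement 0 (FVar a) J))"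
  using assms by (auto elim!: derivable.cases closure_rule.cases)

lemma derivable_boundary_BindE:
  assumes "derivable \<Sigma> T (HB \<Theta> \<Gamma> (Bind A B))"
  obtains a where "a \<notin> vars \<Gamma>" "derivable \<Sigma> T (HJ_thesis \<Theta> \<Gamma> (IsType A))"
    "derivable \<Sigma> T (HB \<Theta> (\<Gamma> @ [(a, A)]) (subst_boundary 0 (FVar a) B))"
  using assms by (auto elim!: derivable.cases closure_rule.cases)

text \<open>The other variables are sent to themselves and typed by the variable rule; no type in
  the extended context mentions \<open>a\<close>, so all types are unchanged.\<close>

lemma typed_subst_single:
  assumes t: "derivable \<Sigma> T (HJ_thesis \<Theta> \<Gamma> (HasType t A))" and a: "a \<notin> vars \<Gamma>"
  shows "typed_subst \<Sigma> T \<Theta> (\<Gamma> @ [(a, A)]) (FVar(a := t)) \<Gamma>"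
proof -
  have v: "valid_mctx \<Sigma> \<Theta>" "valid_vctx \<Sigma> \<Theta> \<Gamma>" "valid_term \<Sigma> (marities \<Theta>) (vars \<Gamma>) 0 t"
    "valid_vctx \<Sigma> \<Theta> (\<Gamma> @ [(a, A)])"
    using derivable_valid[OF t] a by (auto simp: valid_vctx_snoc)
  show ?thesis
    unfolding typed_subst_def
  proof (intro conjI allI impI)
    show "valid_subst \<Sigma> \<Theta> (\<Gamma> @ [(a, A)]) (FVar(a := t)) \<Gamma>"
      using v by (auto simp: valid_subst_def intro: valid_expr.intros term_subst_upd term_subst_FVar)
  next
    fix x B assume x: "map_of (\<Gamma> @ [(a, A)]) x = Some B"
    show "derivable \<Sigma> T (HJ_thesis \<Theta> \<Gamma> (HasType ((FVar(a := t)) x) (fsubst (FVar(a := t)) B)))"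
      using x t a v fsubst_upd_vctx[OF v(4), where \<sigma> = FVar and t = t]
      by (auto simp: map_of_snoc intro: derivable_Var split: if_splits)
  qed
qed

lemma eq_subst_single:
  assumes s: "derivable \<Sigma> T (HJ_thesis \<Theta> \<Gamma> (HasType s A))" and t: "derivable \<Sigma> T (HJ_thesis \<Theta> \<Gamma> (HasType t A))"
    and st: "derivable \<Sigma> T (HJ_thesis \<Theta> \<Gamma> (EqTerm s t A))" and a: "a \<notin> vars \<Gamma>"
  shows "eq_subst \<Sigma> T \<Theta> (\<Gamma> @ [(a, A)]) (FVar(a := s)) (FVar(a := t)) \<Gamma>"
proof -
  have v: "valid_mctx \<Sigma> \<Theta>" "valid_vctx \<Sigma> \<Theta> \<Gamma>" "valid_vctx \<Sigma> \<Theta> (\<Gamma> @ [(a, A)])"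
    using derivable_valid[OF t] a by (auto simp: valid_vctx_snoc)
  \<comment> \<open>Both substitutions fix the variables of \<open>\<Gamma>\<close>, so their
    equations there are reflexivities.\<close>
  have refl: "derivable \<Sigma> T (HJ_thesis \<Theta> \<Gamma> (EqTerm (FVar x) (FVar x) B))" if "map_of \<Gamma> x = Some B" for x B
  proof (rule derivable_rule[OF closure_rule.EqTm_Refl])
    have d: "derivable \<Sigma> T (HJ_thesis \<Theta> \<Gamma> (HasType (FVar x) B))"
      by (rule derivable_Var[OF v(1,2) that])
    then show "\<forall>p \<in> {HJ_thesis \<Theta> \<Gamma> (HasType (FVar x) B)}. derivable \<Sigma> T p" by simp
    show "valid_hypothetical \<Sigma> (HJ_thesis \<Theta> \<Gamma> (EqTerm (FVar x) (FVar x) B))"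
      using derivable_valid[OF d] by simp
  qed
  have "derivable \<Sigma> T (HJ_thesis \<Theta> \<Gamma> (EqTerm ((FVar(a := s)) x) ((FVar(a := t)) x) (fsubst (FVar(a := s)) B)))"
    if x: "map_of (\<Gamma> @ [(a, A)]) x = Some B" for x B
    using x st a v refl fsubst_upd_vctx[OF v(3), where \<sigma> = FVar and t = s]
    by (auto simp: map_of_snoc split: if_splits)
  then show ?thesis
    unfolding eq_subst_def using typed_subst_single[OF s a] typed_subst_single[OF t a] by blast
qed

text \<open>On \<open>V\<close> both substitutions are the identity, so only the opened index
  changes. Each binder of the telescope raises that index by one, which puts it at
  \<open>k + length Bs\<close> in the thesis; \<open>i\<close> separately tracks the level of
  validity.\<close>

lemma eq_judgement_open_binds:
  assumes ts: "term_subst \<sigma>" "term_subst \<tau>"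
    and id: "\<And>x. x \<in> V \<Longrightarrow> \<sigma> x = FVar x" "\<And>x. x \<in> V \<Longrightarrow> \<tau> x = FVar x"
    and "valid_judgement \<Sigma> \<mu> V i (binds Bs j)"
  shows "j = IsType C \<Longrightarrow> eq_judgement \<sigma> \<tau> (subst_judgement k (FVar a) (binds Bs j)) =
      binds (subst_tele k (\<sigma> a) Bs) (EqType (subst (k + length Bs) [\<sigma> a] C) (subst (k + length Bs) [\<tau> a] C))"
    "j = HasType u C \<Longrightarrow> eq_judgement \<sigma> \<tau> (subst_judgement k (FVar a) (binds Bs j)) =
      binds (subst_tele k (\<sigma> a) Bs) (EqTerm (subst (k + length Bs) [\<sigma> a] u)
        (subst (k + length Bs) [\<tau> a] u) (subst (k + length Bs) [\<sigma> a] C))"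
  using assms(5)
proof (induction Bs arbitrary: i k)
  case Nil
  have inv: "fsubst \<sigma> e = e" "fsubst \<tau> e = e" if "valid_expr \<Sigma> \<mu> V i c n e" for i c n e
    using fsubst_cong_valid[OF that, of _ FVar] id by auto
  {
    case 1
    then have "valid_type \<Sigma> \<mu> V i C" by (simp add: binds_def)
    from inv[OF this] 1 show ?case using ts by (simp add: binds_def fsubst_subst)
  next
    case 2
    then have "valid_type \<Sigma> \<mu> V i C" "valid_term \<Sigma> \<mu> V i u" by (simp_all add: binds_def)
    from this[THEN inv(1)] this[THEN inv(2)] 2 show ?case using ts by (simp add: binds_def fsubst_subst)
  }
next
  case (Cons B Bs)
  have inv: "fsubst \<sigma> B = B" if "valid_expr \<Sigma> \<mu> V i c n B" for i c n
    using fsubst_cong_valid[OF that, of _ FVar] id by auto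
  {
    case 1
    then have "valid_type \<Sigma> \<mu> V i B" by (simp add: binds_def)
    from inv[OF this] 1 show ?case
      using ts Cons.IH(1)[of "Suc i" "Suc k"] by (simp add: binds_def fsubst_subst)
  next
    case 2
    then have "valid_type \<Sigma> \<mu> V i B" by (simp add: binds_def)
    from inv[OF this] 2 show ?case
      using ts Cons.IH(2)[of "Suc i" "Suc k"] by (simp add: binds_def fsubst_subst)
  }
qed

text \<open>Substituting \<open>t\<close> for the bound variable is opening it with a fresh
  \<open>a\<close> and then substituting \<open>t\<close> for \<open>a\<close>.\<close>

lemma derivable_subst:
  assumes T: "raw_type_theory \<Sigma> T" and J: "derivable \<Sigma> T (HJ \<Theta> \<Gamma> (Bind A J))"
    and t: "derivable \<Sigma> T (HJ_thesis \<Theta> \<Gamma> (HasType t A))"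
  shows "derivable \<Sigma> T (HJ \<Theta> \<Gamma> (subst_judgement 0 t J))"
proof -
  from J obtain a where a: "a \<notin> vars \<Gamma>"
    and Ja: "derivable \<Sigma> T (HJ \<Theta> (\<Gamma> @ [(a, A)]) (subst_judgement 0 (FVar a) J))"
    by (rule derivable_BindE)
  note typed = typed_subst_single[OF t a]
  have v: "valid_judgement \<Sigma> (marities \<Theta>) (vars \<Gamma>) 1 J"
    using derivable_valid[OF J] by simp
  have "fsubst_judgement (FVar(a := t)) (subst_judgement 0 (FVar a) J) = subst_judgement 0 t J"
    using fsubst_judgement_open[OF v a, of FVar t] typed by (simp add: typed_subst_def valid_subst_def)
  with derivable_fsubst[OF T Ja, of "FVar(a := t)" \<Gamma>] typed show ?thesis by simp
qed

lemma derivable_boundary_subst: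
  assumes T: "raw_type_theory \<Sigma> T" and B: "derivable \<Sigma> T (HB \<Theta> \<Gamma> (Bind A B))"
    and t: "derivable \<Sigma> T (HJ_thesis \<Theta> \<Gamma> (HasType t A))"
  shows "derivable \<Sigma> T (HB \<Theta> \<Gamma> (subst_boundary 0 t B))"
proof -
  from B obtain a where a: "a \<notin> vars \<Gamma>"
    and Ba: "derivable \<Sigma> T (HB \<Theta> (\<Gamma> @ [(a, A)]) (subst_boundary 0 (FVar a) B))"
    by (rule derivable_boundary_BindE)
  note typed = typed_subst_single[OF t a]
  have v: "valid_boundary \<Sigma> (marities \<Theta>) (vars \<Gamma>) 1 B"
    using derivable_valid[OF B] by simp
  have "fsubst_boundary (FVar(a := t)) (subst_boundary 0 (FVar a) B) = subst_boundary 0 t B"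
    using fsubst_boundary_open[OF v a, of FVar t] typed by (simp add: typed_subst_def valid_subst_def)
  with derivable_fsubst[OF T Ba, of "FVar(a := t)" \<Gamma>] typed show ?thesis by simp
qed

lemma derivable_subst_eq:
  assumes T: "raw_type_theory \<Sigma> T" and J: "derivable \<Sigma> T (HJ \<Theta> \<Gamma> (Bind A (binds Bs j)))"
    and s: "derivable \<Sigma> T (HJ_thesis \<Theta> \<Gamma> (HasType s A))" and t: "derivable \<Sigma> T (HJ_thesis \<Theta> \<Gamma> (HasType t A))"
    and st: "derivable \<Sigma> T (HJ_thesis \<Theta> \<Gamma> (EqTerm s t A))"
  shows "j = IsType C \<Longrightarrow> derivable \<Sigma> T (HJ \<Theta> \<Gamma> (binds (subst_tele 0 s Bs)
      (EqType (subst (length Bs) [s] C) (subst (length Bs) [t] C))))"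
    "j = HasType u C \<Longrightarrow> derivable \<Sigma> T (HJ \<Theta> \<Gamma> (binds (subst_tele 0 s Bs)
      (EqTerm (subst (length Bs) [s] u) (subst (length Bs) [t] u) (subst (length Bs) [s] C))))"
proof -
  from J obtain a where a: "a \<notin> vars \<Gamma>"
    and Ja: "derivable \<Sigma> T (HJ \<Theta> (\<Gamma> @ [(a, A)]) (subst_judgement 0 (FVar a) (binds Bs j)))"
    by (rule derivable_BindE)
  define \<sigma> \<tau> where "\<sigma> = FVar(a := s)" and "\<tau> = FVar(a := t)"
  have E: "eq_subst \<Sigma> T \<Theta> (\<Gamma> @ [(a, A)]) \<sigma> \<tau> \<Gamma>"
    unfolding \<sigma>_def \<tau>_def by (rule eq_subst_single[OF s t st a])
  have at: "\<sigma> a = s" "\<tau> a = t" by (simp_all add: \<sigma>_def \<tau>_def)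
  have ts: "term_subst \<sigma>" "term_subst \<tau>"
    using E by (auto simp: eq_subst_def typed_subst_def valid_subst_def)
  have id: "\<And>x. x \<in> vars \<Gamma> \<Longrightarrow> \<sigma> x = FVar x" "\<And>x. x \<in> vars \<Gamma> \<Longrightarrow> \<tau> x = FVar x"
    using a by (auto simp: \<sigma>_def \<tau>_def)
  have v: "valid_judgement \<Sigma> (marities \<Theta>) (vars \<Gamma>) 1 (binds Bs j)"
    using derivable_valid[OF J] by simp
  \<comment> \<open>Equal substitution is applied to the opened premise;
    \<open>eq_judgement_open_binds\<close> then rewrites the result in telescope form.\<close>
  have d: "derivable \<Sigma> T (HJ \<Theta> \<Gamma> (eq_judgement \<sigma> \<tau> (subst_judgement 0 (FVar a) (binds Bs j))))"
    using derivable_eq_fsubst[OF T Ja, of \<sigma> \<tau> \<Gamma>] E by simp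
  show "j = IsType C \<Longrightarrow> derivable \<Sigma> T (HJ \<Theta> \<Gamma> (binds (subst_tele 0 s Bs)
      (EqType (subst (length Bs) [s] C) (subst (length Bs) [t] C))))"
    using d eq_judgement_open_binds(1)[OF ts id v, of C 0 a] by (simp add: at)
  show "j = HasType u C \<Longrightarrow> derivable \<Sigma> T (HJ \<Theta> \<Gamma> (binds (subst_tele 0 s Bs)
      (EqTerm (subst (length Bs) [s] u) (subst (length Bs) [t] u) (subst (length Bs) [s] C))))"
    using d eq_judgement_open_binds(2)[OF ts id v, of u C 0 a] by (simp add: at)
qed

text \<open>The identity is a typed substitution from the context with \<open>a : A\<close> to the
  one with \<open>a : B\<close>, because there \<open>a\<close> has type \<open>A\<close> by
  conversion.\<close>

lemma derivable_conv_abstr: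
  assumes T: "raw_type_theory \<Sigma> T" and J: "derivable \<Sigma> T (HJ \<Theta> \<Gamma> (Bind A J))"
    and B: "derivable \<Sigma> T (HJ_thesis \<Theta> \<Gamma> (IsType B))" and AB: "derivable \<Sigma> T (HJ_thesis \<Theta> \<Gamma> (EqType A B))"
  shows "derivable \<Sigma> T (HJ \<Theta> \<Gamma> (Bind B J))"
proof -
  from J obtain a where a: "a \<notin> vars \<Gamma>"
    and Ja: "derivable \<Sigma> T (HJ \<Theta> (\<Gamma> @ [(a, A)]) (subst_judgement 0 (FVar a) J))"
    by (rule derivable_BindE)
  let ?\<Delta> = "\<Gamma> @ [(a, B)]"
  have v: "valid_mctx \<Sigma> \<Theta>" "valid_vctx \<Sigma> \<Theta> \<Gamma>" "valid_vctx \<Sigma> \<Theta> ?\<Delta>" "valid_vctx \<Sigma> \<Theta> (\<Gamma> @ [(a, A)])"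
    using derivable_valid[OF AB] a by (auto simp: valid_vctx_snoc)
  \<comment> \<open>Symmetry is needed since the variable is now declared with type \<open>B\<close>
    and must be converted back to \<open>A\<close>.\<close>
  have BA: "derivable \<Sigma> T (HJ_thesis \<Theta> \<Gamma> (EqType B A))"
    by (rule derivable_rule[OF closure_rule.EqTy_Sym]) (use AB derivable_valid[OF AB] in auto)
  have BA': "derivable \<Sigma> T (HJ_thesis \<Theta> ?\<Delta> (EqType B A))"
    by (rule derivable_weakening[OF T BA v(3)])
  have aB: "derivable \<Sigma> T (HJ_thesis \<Theta> ?\<Delta> (HasType (FVar a) B))"
    using v a by (intro derivable_Var) (auto simp: map_of_snoc)
  have aA: "derivable \<Sigma> T (HJ_thesis \<Theta> ?\<Delta> (HasType (FVar a) A))"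
    by (rule derivable_rule[OF closure_rule.Conv_Tm])
      (use aB BA' derivable_valid[OF aB] derivable_valid[OF BA'] in auto)
  have "typed_subst \<Sigma> T \<Theta> \<Gamma> FVar \<Gamma>"
    using v by (auto simp: typed_subst_def valid_subst_def term_subst_FVar intro: derivable_Var valid_expr.intros)
  \<comment> \<open>Updating \<open>FVar\<close> at \<open>a\<close> with \<open>FVar a\<close> is
    again \<open>FVar\<close>, so this substitution changes the context and leaves \<open>J\<close>
    as it is.\<close>
  from typed_subst_lift[OF T this v(4,3)] aA
  have "typed_subst \<Sigma> T \<Theta> (\<Gamma> @ [(a, A)]) FVar ?\<Delta>" by simp
  with derivable_fsubst[OF T Ja, of FVar ?\<Delta>]
  have "derivable \<Sigma> T (HJ \<Theta> ?\<Delta> (subst_judgement 0 (FVar a) J))" by simp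
  with B derivable_valid[OF J] derivable_valid[OF B] show ?thesis
    by (intro derivable_rule[OF closure_rule.Abstr[OF a]]) auto
qed

theorem mainTheorem2:
  fixes \<Sigma> :: "'s signature" and T :: "'s raw_rule set"
  assumes "raw_type_theory \<Sigma> T"
  shows
    "(\<forall>\<Theta> \<Gamma> A J t.
        admissible \<Sigma> T
          {HJ \<Theta> \<Gamma> (Bind A J), HJ \<Theta> \<Gamma> (Thesis (HasType t A))}
          (HJ \<Theta> \<Gamma> (subst_judgement 0 t J)))
   \<and> (\<forall>\<Theta> \<Gamma> A B t.
        admissible \<Sigma> T
          {HB \<Theta> \<Gamma> (Bind A B), HJ \<Theta> \<Gamma> (Thesis (HasType t A))}
          (HB \<Theta> \<Gamma> (subst_boundary 0 t B)))
   \<and> (\<forall>\<Theta> \<Gamma> A Bs C s t.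
        admissible \<Sigma> T
          {HJ \<Theta> \<Gamma> (Bind A (binds Bs (IsType C))),
           HJ \<Theta> \<Gamma> (Thesis (HasType s A)),
           HJ \<Theta> \<Gamma> (Thesis (HasType t A)),
           HJ \<Theta> \<Gamma> (Thesis (EqTerm s t A))}
          (HJ \<Theta> \<Gamma> (binds (subst_tele 0 s Bs)
            (EqType (subst (length Bs) [s] C) (subst (length Bs) [t] C)))))
   \<and> (\<forall>\<Theta> \<Gamma> A Bs u C s t.
        admissible \<Sigma> T
          {HJ \<Theta> \<Gamma> (Bind A (binds Bs (HasType u C))),
           HJ \<Theta> \<Gamma> (Thesis (HasType s A)),
           HJ \<Theta> \<Gamma> (Thesis (HasType t A)),
           HJ \<Theta> \<Gamma> (Thesis (EqTerm s t A))}
          (HJ \<Theta> \<Gamma> (binds (subst_tele 0 s Bs)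
            (EqTerm (subst (length Bs) [s] u) (subst (length Bs) [t] u) (subst (length Bs) [s] C)))))
   \<and> (\<forall>\<Theta> \<Gamma> A B J.
        admissible \<Sigma> T
          {HJ \<Theta> \<Gamma> (Bind A J),
           HJ \<Theta> \<Gamma> (Thesis (IsType B)),
           HJ \<Theta> \<Gamma> (Thesis (EqType A B))}
          (HJ \<Theta> \<Gamma> (Bind B J)))"
  unfolding admissible_def
proof (intro conjI allI impI, goal_cases)
  case (1 \<Theta> \<Gamma> A J t)
  then show ?case using derivable_subst[OF assms, of \<Theta> \<Gamma> A J t] by simp
next
  case (2 \<Theta> \<Gamma> A B t)
  then show ?case using derivable_boundary_subst[OF assms, of \<Theta> \<Gamma> A B t] by simp
next
  case (3 \<Theta> \<Gamma> A Bs C s t)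
  then show ?case using derivable_subst_eq(1)[OF assms, of \<Theta> \<Gamma> A Bs "IsType C" s t C] by simp
next
  case (4 \<Theta> \<Gamma> A Bs u C s t)
  then show ?case using derivable_subst_eq(2)[OF assms, of \<Theta> \<Gamma> A Bs "HasType u C" s t u C] by simp
next
  case (5 \<Theta> \<Gamma> A B J)
  then show ?case using derivable_conv_abstr[OF assms, of \<Theta> \<Gamma> A J B] by simp
qed

end
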